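(* Let $(T_n)_{n\ge1}$ be a positively divergent perturbed random walk, $a>0$ and $R:=-\log\inf_{t\ge0}\mathbb{E}e^{-t\xi}$. For $y\in\mathbb{R}$ put $V_a(y):=\sum_{n\ge1}e^{an}\,\mathbb{P}\{T_n\le y\}$. (a) Assume that $\mathbb{P}\{\xi\ge0\}=1$. Let $x\in\mathbb{R}$ and assume that $\mathbb{P}\{\eta\le x\}>0$. Then the following assertions are equivalent: (1) $\mathbb{E}\exp(a\rho(x))<\infty$; (2) $V_a(y)<\infty$ for some/all $y\ge x$; (3) $a<-\log\mathbb{P}\{\xi=0\}$ and $\mathbb{E}e^{-\gamma\eta}<\infty$, where $\gamma$ is the unique positive number satisfying $\mathbb{E}e^{-\gamma\xi}=e^{-a}$. (b) If $\mathbb{P}\{\xi<0\}>0$, then the following assertions are equivalent: (4) $\mathbb{E}\exp(a\rho(x))<\infty$ for some/all $x\in\mathbb{R}$; (5) $V_a(x)<\infty$ for some/all $x\in\mathbb{R}$; (6) either $a<R$ and $\mathbb{E}e^{-\gamma\eta}<\infty$, or $a=R$, $\mathbb{E}\,\xi e^{-\gamma\xi}>0$ and $\mathbb{E}e^{-\gamma\eta}<\infty$, where $\gamma$ is the minimal positive number satisfying $\mathbb{E}e^{-\gamma\xi}=e^{-a}$.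
   Context: Let $(\xi,\eta),(\xi_1,\eta_1),(\xi_2,\eta_2),\ldots$ be i.i.d. $\mathbb{R}^2$-valued random vectors; no condition is imposed on the dependence between $\xi$ and $\eta$. Put $S_0:=0$, $S_n:=\xi_1+\cdots+\xi_n$ for $n\in\mathbb{N}=\{1,2,\ldots\}$, and $T_n:=S_{n-1}+\eta_n$ for $n\in\mathbb{N}$; $(T_n)_{n\ge1}$ is called a perturbed random walk. Standing assumption: $\mathbb{P}\{\xi=0\}<1$ and $\mathbb{P}\{\eta=0\}<1$. The perturbed random walk is called positively divergent if $\lim_{n\to\infty}T_n=\infty$ a.s. For $x\in\mathbb{R}$, $\rho(x):=\sup\{n\in\mathbb{N}:T_n\le x\}$, with $\sup\emptyset:=0$. Convention: $-\log 0:=\infty$. An assertion "for some/all $x$" in a list of equivalent assertions means that both the version with "for some $x$" and the version with "for all $x$" belong to the list of equivalent assertions. *)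

theory Defs
  imports "HOL-Probability.Probability"
begin

text \<open>
  The pair with index 0 is the generic copy $(\xi,\eta)$; the perturbed random walk is
  built from the pairs with indices $1, 2, \ldots$ only.
\<close>

locale iid_pairs = prob_space M
  for M :: "'a measure" and \<xi> \<eta> :: "nat \<Rightarrow> 'a \<Rightarrow> real" +
  assumes indep: "indep_vars (\<lambda>_. borel) (\<lambda>n \<omega>. (\<xi> n \<omega>, \<eta> n \<omega>)) UNIV"
    and ident: "\<And>n. distr M borel (\<lambda>\<omega>. (\<xi> n \<omega>, \<eta> n \<omega>)) = distr M borel (\<lambda>\<omega>. (\<xi> 0 \<omega>, \<eta> 0 \<omega>))"
    and \<xi>_nondeg: "\<P>(\<omega> in M. \<xi> 0 \<omega> = 0) < 1"
    and \<eta>_nondeg: "\<P>(\<omega> in M. \<eta> 0 \<omega> = 0) < 1"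

definition walk :: "(nat \<Rightarrow> 'a \<Rightarrow> real) \<Rightarrow> nat \<Rightarrow> 'a \<Rightarrow> real" where
  "walk \<xi> n \<omega> = (\<Sum>k=1..n. \<xi> k \<omega>)"

text \<open>Only used for \<open>n \<ge> 1\<close>; the value at \<open>n = 0\<close> has no meaning.\<close>

definition perturbed_walk ::
  "(nat \<Rightarrow> 'a \<Rightarrow> real) \<Rightarrow> (nat \<Rightarrow> 'a \<Rightarrow> real) \<Rightarrow> nat \<Rightarrow> 'a \<Rightarrow> real" where
  "perturbed_walk \<xi> \<eta> n \<omega> = walk \<xi> (n - 1) \<omega> + \<eta> n \<omega>"

definition positively_divergent ::
  "'a measure \<Rightarrow> (nat \<Rightarrow> 'a \<Rightarrow> real) \<Rightarrow> (nat \<Rightarrow> 'a \<Rightarrow> real) \<Rightarrow> bool" where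
  "positively_divergent M \<xi> \<eta> \<longleftrightarrow>
     (AE \<omega> in M. filterlim (\<lambda>n. perturbed_walk \<xi> \<eta> n \<omega>) at_top sequentially)"

text \<open>In \<^typ>\<open>enat\<close> the supremum of the empty set is 0 and that of an infinite set is \<open>\<infinity>\<close>.\<close>

definition last_exit ::
  "(nat \<Rightarrow> 'a \<Rightarrow> real) \<Rightarrow> (nat \<Rightarrow> 'a \<Rightarrow> real) \<Rightarrow> real \<Rightarrow> 'a \<Rightarrow> enat" where
  "last_exit \<xi> \<eta> x \<omega> = Sup (enat ` {n. 1 \<le> n \<and> perturbed_walk \<xi> \<eta> n \<omega> \<le> x})"

definition exp_enat :: "real \<Rightarrow> enat \<Rightarrow> ennreal" where
  "exp_enat a N = (case N of enat n \<Rightarrow> ennreal (exp (a * real n)) | \<infinity> \<Rightarrow> \<infinity>)"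

definition last_exit_exp_moment ::
  "'a measure \<Rightarrow> (nat \<Rightarrow> 'a \<Rightarrow> real) \<Rightarrow> (nat \<Rightarrow> 'a \<Rightarrow> real) \<Rightarrow> real \<Rightarrow> real \<Rightarrow> ennreal" where
  "last_exit_exp_moment M \<xi> \<eta> a x = (\<integral>\<^sup>+\<omega>. exp_enat a (last_exit \<xi> \<eta> x \<omega>) \<partial>M)"

text \<open>The function $V_a$; the term with summation index \<open>n\<close> belongs to $T_{n+1}$.\<close>

definition exp_renewal ::
  "'a measure \<Rightarrow> (nat \<Rightarrow> 'a \<Rightarrow> real) \<Rightarrow> (nat \<Rightarrow> 'a \<Rightarrow> real) \<Rightarrow> real \<Rightarrow> real \<Rightarrow> ennreal" where
  "exp_renewal M \<xi> \<eta> a y =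
     (\<Sum>n. ennreal (exp (a * real (Suc n))) *
           emeasure M {\<omega> \<in> space M. perturbed_walk \<xi> \<eta> (Suc n) \<omega> \<le> y})"

definition laplace :: "'a measure \<Rightarrow> ('a \<Rightarrow> real) \<Rightarrow> real \<Rightarrow> ennreal" where
  "laplace M X t = (\<integral>\<^sup>+\<omega>. ennreal (exp (- t * X \<omega>)) \<partial>M)"

text \<open>
  $\mathbb{E} X e^{-tX}$. For \<open>t > 0\<close> the positive part of the integrand is bounded, so the
  expectation always exists in $[-\infty,\infty)$. The Bochner integral is 0 where it is
  $-\infty$, hence is positive exactly if the extended expectation is.
\<close>

definition tilted_mean :: "'a measure \<Rightarrow> ('a \<Rightarrow> real) \<Rightarrow> real \<Rightarrow> real" where
  "tilted_mean M X t = (\<integral>\<omega>. X \<omega> * exp (- t * X \<omega>) \<partial>M)"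

definition neg_ln :: "ennreal \<Rightarrow> ereal" where
  "neg_ln p = (if p = 0 then \<infinity> else if p = \<infinity> then - \<infinity> else ereal (- ln (enn2real p)))"

definition R_exponent :: "'a measure \<Rightarrow> ('a \<Rightarrow> real) \<Rightarrow> ereal" where
  "R_exponent M X = neg_ln (INF t\<in>{0..}. laplace M X t)"

definition exponent_roots :: "'a measure \<Rightarrow> ('a \<Rightarrow> real) \<Rightarrow> real \<Rightarrow> real set" where
  "exponent_roots M X a = {\<gamma>. 0 < \<gamma> \<and> laplace M X \<gamma> = ennreal (exp (- a))}"

definition is_unique_root :: "'a measure \<Rightarrow> ('a \<Rightarrow> real) \<Rightarrow> real \<Rightarrow> real \<Rightarrow> bool" where
  "is_unique_root M X a \<gamma> \<longleftrightarrow>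
     \<gamma> \<in> exponent_roots M X a \<and> (\<forall>\<gamma>'\<in>exponent_roots M X a. \<gamma>' = \<gamma>)"

definition is_minimal_root :: "'a measure \<Rightarrow> ('a \<Rightarrow> real) \<Rightarrow> real \<Rightarrow> real \<Rightarrow> bool" where
  "is_minimal_root M X a \<gamma> \<longleftrightarrow>
     \<gamma> \<in> exponent_roots M X a \<and> (\<forall>\<gamma>'\<in>exponent_roots M X a. \<gamma> \<le> \<gamma>')"

end

theory Submission
  imports Defs "HOL-Real_Asymp.Real_Asymp"
begin

text \<open>
  Since $e^{a\rho(x)}$ lies between constant multiples of $\sum_n e^{an} 1\{T_n \le x\}$ and of one plus
  that sum, the moment is finite iff $V_a(x)$ is, and $V_a(y) = e^a\, E\, U(y - \eta)$ with
  $U(s) = \sum_{n \ge 0} e^{an} P\{S_n \le s\}$ the renewal function of the measure $\nu = e^a P_\xi$. Everything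
  reduces to the growth of $U$. Let $\varphi(t) = \int e^{-ty}\,\nu(dy)$, so that the roots are the
  $\gamma > 0$ with $\varphi(\gamma) = 1$.

  If $U$ is finite, it is submultiplicative up to a constant, and comparing the Laplace transforms
  in $U \ge \nu * U$ at the growth rate $t$ of $U$ gives $\varphi(t) \le 1$. Hence a minimal root $\gamma \le t$
  exists, $U(s) \ge c e^{\gamma s}$ for $s \ge 0$, and finiteness of $V_a$ forces $E e^{-\gamma\eta} < \infty$.
  Conversely, a maximum principle for the excessive function $e^{\gamma s}$ gives $U(s) \le C e^{\gamma s}$
  as soon as $U$ is finite, hence $V_a < \infty$ if $E e^{-\gamma\eta} < \infty$.

  It remains to decide when $U$ is finite. If $\varphi(t) < 1$ for some $t \ge 0$, this is Chernoff's
  bound. At the critical value $a = R$ it amounts to transience of the walk tilted by $e^{-\gamma y}$,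
  which holds iff the tilted mean is positive: positivity yields a bounded strictly superharmonic
  function by a maximal ergodic argument, and conversely the Laplace transform of the renewal
  equation for $t$ slightly below $\gamma$ bounds the slope of $\varphi$ at $\gamma$ away from zero.
\<close>

section \<open>Potentials of measures on the real line\<close>

text \<open>Two obstacles shape the proof. The potentials may be infinite, and the negative part of
  \<xi> need not have an exponential moment, so finiteness can be assumed of neither U nor
  \<varphi>. Potentials therefore take values in \<open>ennreal\<close> and are handled through
  finite truncations: a decomposition at a first entrance or first passage becomes an induction on
  the number of steps, and no stopping times or path spaces appear. To the right of the minimal root
  \<varphi> may be infinite. The slope at the root is thus accessible from the left only, and this
  is where minimality enters: on \<open>[0, \<gamma>)\<close> the transform stays above 1, so a
  quantitative gap can be extracted there. At the critical value neither a law of large numbers nor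
  the recurrence of mean-zero walks is invoked. Recurrence is replaced by the slope bound,
  transience by a strict deficit of the hitting probability, which can serve directly as a
  supersolution.\<close>

text \<open>
  The underlying walk moves from \<open>s\<close> to \<open>s - y\<close>: with \<open>\<nu>\<close> the law of \<open>\<xi>\<close>, \<open>renewal \<nu> s\<close> is the
  expected number of $n \ge 0$ with $S_n \le s$.
\<close>

definition step :: "real measure \<Rightarrow> (real \<Rightarrow> ennreal) \<Rightarrow> real \<Rightarrow> ennreal" where
  "step \<nu> h s = (\<integral>\<^sup>+y. h (s - y) \<partial>\<nu>)"

definition potential_upto :: "real measure \<Rightarrow> nat \<Rightarrow> (real \<Rightarrow> ennreal) \<Rightarrow> real \<Rightarrow> ennreal" where
  "potential_upto \<nu> N h s = (\<Sum>n<N. (step \<nu> ^^ n) h s)"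

definition potential :: "real measure \<Rightarrow> (real \<Rightarrow> ennreal) \<Rightarrow> real \<Rightarrow> ennreal" where
  "potential \<nu> h s = (\<Sum>n. (step \<nu> ^^ n) h s)"

definition renewal :: "real measure \<Rightarrow> real \<Rightarrow> ennreal" where
  "renewal \<nu> = potential \<nu> (indicator {0..})"

abbreviation lap :: "real measure \<Rightarrow> real \<Rightarrow> ennreal" where
  "lap \<nu> \<equiv> laplace \<nu> (\<lambda>y. y)"

context finite_borel_measure
begin

lemma sets_eq [measurable_cong]: "sets M = sets borel"
  by (fact M_is_borel)

lemma measurable_step [measurable]:
  assumes [measurable]: "h \<in> borel_measurable borel"
  shows "step M h \<in> borel_measurable borel"
  unfolding step_def by measurable

lemma measurable_step_pow [measurable]:
  assumes [measurable]: "h \<in> borel_measurable borel"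
  shows "(step M ^^ n) h \<in> borel_measurable borel"
  by (induction n) auto

lemma measurable_potential_upto [measurable]:
  assumes [measurable]: "h \<in> borel_measurable borel"
  shows "potential_upto M N h \<in> borel_measurable borel"
  unfolding potential_upto_def[abs_def] by measurable

lemma measurable_potential [measurable]:
  assumes [measurable]: "h \<in> borel_measurable borel"
  shows "potential M h \<in> borel_measurable borel"
  unfolding potential_def[abs_def] by measurable

lemma measurable_renewal [measurable]: "renewal M \<in> borel_measurable borel"
  unfolding renewal_def by measurable

lemma step_mono: "(\<And>s. g s \<le> h s) \<Longrightarrow> step M g s \<le> step M h s"
  unfolding step_def by (intro nn_integral_mono) auto

lemma step_pow_mono: "(\<And>s. g s \<le> h s) \<Longrightarrow> (step M ^^ n) g s \<le> (step M ^^ n) h s"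
  by (induction n arbitrary: s) (auto intro: step_mono)

lemma potential_mono: "(\<And>s. g s \<le> h s) \<Longrightarrow> potential M g s \<le> potential M h s"
  unfolding potential_def by (intro suminf_le step_pow_mono) auto

lemma step_add:
  assumes [measurable]: "g \<in> borel_measurable borel" "h \<in> borel_measurable borel"
  shows "step M (\<lambda>s. g s + h s) s = step M g s + step M h s"
  unfolding step_def by (subst nn_integral_add) auto

lemma step_cmult:
  assumes [measurable]: "h \<in> borel_measurable borel"
  shows "step M (\<lambda>s. c * h s) s = c * step M h s"
  unfolding step_def by (subst nn_integral_cmult) auto

lemma step_suminf:
  assumes [measurable]: "\<And>n::nat. h n \<in> borel_measurable borel"
  shows "step M (\<lambda>s. \<Sum>n. h n s) s = (\<Sum>n. step M (h n) s)"
  unfolding step_def by (subst nn_integral_suminf) auto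

lemma step_pow_suminf:
  assumes [measurable]: "\<And>n::nat. h n \<in> borel_measurable borel"
  shows "(step M ^^ k) (\<lambda>s. \<Sum>n. h n s) = (\<lambda>s. \<Sum>n. (step M ^^ k) (h n) s)"
proof (induction k)
  case (Suc k)
  show ?case
    by (simp add: Suc step_suminf fun_eq_iff)
qed simp

lemma step_const: "step M (\<lambda>_. c) s = c * emeasure M UNIV"
  unfolding step_def using sets_eq_imp_space_eq[OF sets_eq] by simp

lemma step_shift: "step M (\<lambda>s. h (s + t)) s = step M h (s + t)"
  unfolding step_def by (simp add: algebra_simps)

lemma step_pow_shift: "(step M ^^ n) (\<lambda>s. h (s + t)) = (\<lambda>s. (step M ^^ n) h (s + t))"
proof (induction n)
  case (Suc n)
  show ?case by (simp add: Suc fun_eq_iff step_shift[of "(step M ^^ n) h"])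
qed simp

lemma potential_shift: "potential M (\<lambda>s. h (s + t)) s = potential M h (s + t)"
  unfolding potential_def by (simp add: step_pow_shift)

lemma potential_upto_0: "potential_upto M 0 h s = 0"
  by (simp add: potential_upto_def)

lemma potential_upto_Suc:
  assumes [measurable]: "h \<in> borel_measurable borel"
  shows "potential_upto M (Suc N) h s = h s + step M (potential_upto M N h) s"
proof -
  have "step M (potential_upto M N h) s = (\<Sum>n<N. (step M ^^ (Suc n)) h s)"
    unfolding potential_upto_def
    by (subst step_def, subst nn_integral_sum) (simp_all add: step_def[symmetric])
  then show ?thesis
    unfolding potential_upto_def by (simp add: sum.lessThan_Suc_shift del: sum.lessThan_Suc)
qed

lemma potential_eq_SUP: "potential M h s = (SUP N. potential_upto M N h s)"
  unfolding potential_def potential_upto_def by (rule suminf_eq_SUP)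

lemma potential_upto_le: "potential_upto M N h s \<le> potential M h s"
  unfolding potential_eq_SUP by (rule SUP_upper) simp

lemma potential_leI: "(\<And>N. potential_upto M N h s \<le> c) \<Longrightarrow> potential M h s \<le> c"
  unfolding potential_eq_SUP by (rule SUP_least)

lemma potential_eq:
  assumes [measurable]: "h \<in> borel_measurable borel"
  shows "potential M h s = h s + step M (potential M h) s"
proof -
  have "potential M h s = h s + (\<Sum>n. (step M ^^ (Suc n)) h s)"
    unfolding potential_def
    by (subst suminf_offset[of _ 1]) auto
  also have "(\<Sum>n. (step M ^^ (Suc n)) h s) = step M (potential M h) s"
    unfolding potential_def[abs_def] by (subst step_suminf) auto
  finally show ?thesis .
qed

lemma potential_suminf:
  assumes [measurable]: "\<And>n::nat. h n \<in> borel_measurable borel"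
  shows "potential M (\<lambda>s. \<Sum>n. h n s) s = (\<Sum>n. potential M (h n) s)"
proof -
  have "potential M (\<lambda>s. \<Sum>n. h n s) s = (\<Sum>k. \<Sum>n. (step M ^^ k) (h n) s)"
    unfolding potential_def by (simp add: step_pow_suminf)
  also have "\<dots> = (\<Sum>n. potential M (h n) s)"
    unfolding potential_def
    by (subst nn_integral_count_space_nat[symmetric], subst nn_integral_suminf)
       (simp_all add: nn_integral_count_space_nat)
  finally show ?thesis .
qed

text \<open>The potential is the least solution of \<open>w = \<phi> + step M w\<close>. Each
  truncation stays below \<open>w\<close> by induction, even where \<open>w\<close> is
  infinite.\<close>

lemma potential_le_supersolution:
  assumes [measurable]: "\<phi> \<in> borel_measurable borel"
    and "\<And>s. \<phi> s + step M w s \<le> w s"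
  shows "potential M \<phi> s \<le> w s"
proof (rule potential_leI)
  fix N
  show "potential_upto M N \<phi> s \<le> w s"
  proof (induction N arbitrary: s)
    case (Suc N)
    have "potential_upto M (Suc N) \<phi> s \<le> \<phi> s + step M w s"
      unfolding potential_upto_Suc[OF assms(1)] by (intro add_left_mono step_mono Suc)
    also note assms(2)
    finally show ?case .
  qed (simp add: potential_upto_0)
qed

text \<open>Nothing is collected before the walk enters the support of \<open>\<phi>\<close>. Off
  the support a truncated potential is one step of the preceding one, and excessivity of
  \<open>e\<close> carries the bound over; on the support the hypothesis applies.\<close>

lemma potential_max_principle:
  assumes [measurable]: "\<phi> \<in> borel_measurable borel" "e \<in> borel_measurable borel"
    and sup: "\<And>s. step M e s \<le> e s"
    and le: "\<And>s. \<phi> s \<noteq> 0 \<Longrightarrow> potential M \<phi> s \<le> D * e s"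
  shows "potential M \<phi> s \<le> D * e s"
proof (rule potential_leI)
  fix N
  show "potential_upto M N \<phi> s \<le> D * e s"
  proof (induction N arbitrary: s)
    case (Suc N)
    show ?case
    proof (cases "\<phi> s = 0")
      case True
      have "potential_upto M (Suc N) \<phi> s = step M (potential_upto M N \<phi>) s"
        by (simp add: potential_upto_Suc True)
      also have "\<dots> \<le> step M (\<lambda>s. D * e s) s"
        by (intro step_mono Suc)
      also have "\<dots> = D * step M e s"
        by (simp add: step_cmult)
      also have "\<dots> \<le> D * e s"
        by (intro mult_left_mono sup) auto
      finally show ?thesis .
    next
      case False
      then show ?thesis
        by (meson le order_trans potential_upto_le)
    qed
  qed (simp add: potential_upto_0)
qed

section \<open>Exponentials as eigenfunctions, and bounds for the renewal function\<close>

lemma step_exp: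
  "step M (\<lambda>s. ennreal (exp (t * s))) s = ennreal (exp (t * s)) * lap M t"
proof -
  have "step M (\<lambda>s. ennreal (exp (t * s))) s
      = (\<integral>\<^sup>+y. ennreal (exp (t * s)) * ennreal (exp (- t * y)) \<partial>M)"
    unfolding step_def
    by (intro nn_integral_cong) (simp add: ennreal_mult[symmetric] exp_add[symmetric] algebra_simps)
  also have "\<dots> = ennreal (exp (t * s)) * lap M t"
    unfolding laplace_def by (subst nn_integral_cmult) auto
  finally show ?thesis .
qed

lemma mono_step: "mono h \<Longrightarrow> mono (step M h)"
  unfolding step_def by (intro monoI nn_integral_mono) (auto elim: monoD)

lemma mono_renewal: "s \<le> t \<Longrightarrow> renewal M s \<le> renewal M t"
proof -
  have "mono ((step M ^^ n) (indicator {0..}))" for n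
    by (induction n) (simp_all add: mono_step, auto intro!: monoI split: split_indicator)
  then show "s \<le> t \<Longrightarrow> renewal M s \<le> renewal M t"
    unfolding renewal_def potential_def by (auto intro!: suminf_le dest: monoD)
qed

lemma renewal_eq: "renewal M s = indicator {0..} s + step M (renewal M) s"
  unfolding renewal_def by (rule potential_eq) auto

lemma renewal_ge_1: "s \<ge> 0 \<Longrightarrow> 1 \<le> renewal M s"
  by (subst renewal_eq) auto

text \<open>Since \<open>t \<ge> 0\<close>, the indicator of \<open>{0..}\<close> lies below
  \<open>exp (t * s)\<close>. The factor \<open>1 / (1 - q)\<close> is the geometric series:
  \<open>exp (t * s) / (1 - q)\<close> solves the potential equation with charge
  \<open>exp (t * s)\<close> exactly.\<close>

lemma renewal_finite_if_lap_less_1: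
  assumes "lap M t < 1" "t \<ge> 0"
  shows "renewal M s < \<infinity>"
proof -
  obtain q where q: "lap M t = ennreal q" "0 \<le> q" "q < 1"
    using assms(1) by (cases "lap M t") (auto simp: ennreal_less_one_iff)
  have "renewal M s \<le> ennreal (1 / (1 - q)) * ennreal (exp (t * s))"
    unfolding renewal_def
  proof (rule potential_le_supersolution)
    fix s :: real
    have "indicator {0..} s + step M (\<lambda>s. ennreal (1 / (1 - q)) * ennreal (exp (t * s))) s
        \<le> ennreal (exp (t * s)) + ennreal (1 / (1 - q)) * (ennreal (exp (t * s)) * ennreal q)"
      using assms by (intro add_mono) (auto simp: step_cmult step_exp q split: split_indicator)
    also have "\<dots> = ennreal (exp (t * s) + 1 / (1 - q) * (exp (t * s) * q))"
      using q by (simp add: ennreal_mult[symmetric] ennreal_plus[symmetric] del: ennreal_plus)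
    also have "exp (t * s) + 1 / (1 - q) * (exp (t * s) * q) = 1 / (1 - q) * exp (t * s)"
      using q by (simp add: field_simps)
    also have "ennreal \<dots> = ennreal (1 / (1 - q)) * ennreal (exp (t * s))"
      using q by (subst ennreal_mult) auto
    finally show "indicator {0..} s + step M (\<lambda>s. ennreal (1 / (1 - q)) * ennreal (exp (t * s))) s
        \<le> ennreal (1 / (1 - q)) * ennreal (exp (t * s))" .
  qed auto
  also have "\<dots> < \<infinity>"
    by (simp add: ennreal_mult_less_top)
  finally show ?thesis .
qed

text \<open>
  Splitting the walk at its first passage above \<open>s\<close> gives this bound; the induction on the number of
  steps avoids speaking of the passage time.
\<close>

lemma renewal_submultiplicative_aux:
  assumes "t \<ge> 0"
  shows "potential_upto M N (indicator {0..}) (s + t) \<le> potential_upto M N (indicator {0..}) s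
    + (1 + emeasure M UNIV * potential_upto M N (indicator {0..}) s) * renewal M t"
proof (induction N arbitrary: s)
  case (Suc N)
  let ?u = "\<lambda>N. potential_upto M N (indicator {0..})" and ?m = "emeasure M UNIV"
  show ?case
  \<comment> \<open>The coefficient \<open>1 + ?m * ?u N s\<close> bounds the total weight of first
    passages: either the start is already negative, or the passage is one step, of mass
    \<open>?m\<close>, from a point counted by \<open>?u N s\<close>. After it, at most
    \<open>renewal M t\<close> remains.\<close>
  proof (cases "s \<ge> 0")
    case False
    have "?u (Suc N) (s + t) \<le> renewal M (s + t)"
      unfolding renewal_def by (rule potential_upto_le)
    also have "\<dots> \<le> renewal M t"
      using False by (intro mono_renewal) auto
    also have "\<dots> = 0 + 1 * renewal M t" by simp
    also have "\<dots> \<le> ?u (Suc N) s + (1 + ?m * ?u (Suc N) s) * renewal M t"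
      by (intro add_mono mult_right_mono) auto
    finally show ?thesis .
  next
    case True
    have "?u (Suc N) (s + t) = 1 + step M (\<lambda>s. ?u N (s + t)) s"
      using True assms by (simp add: potential_upto_Suc step_shift)
    also have "\<dots> \<le> 1 + step M (\<lambda>s. ?u N s + (1 + ?m * ?u N s) * renewal M t) s"
      by (intro add_left_mono step_mono Suc)
    also have "step M (\<lambda>s. ?u N s + (1 + ?m * ?u N s) * renewal M t) s
        = step M (\<lambda>s. ?u N s + (renewal M t + (?m * renewal M t) * ?u N s)) s"
      by (simp add: algebra_simps)
    also have "\<dots> = step M (?u N) s + (?m * renewal M t + ?m * renewal M t * step M (?u N) s)"
      by (simp add: step_add step_const step_cmult mult.commute[of "renewal M t" ?m])
    also have "1 + \<dots> = ?u (Suc N) s + ?m * renewal M t * ?u (Suc N) s"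
      using True by (simp add: potential_upto_Suc algebra_simps)
    also have "\<dots> \<le> ?u (Suc N) s + (1 + ?m * ?u (Suc N) s) * renewal M t"
      by (intro add_left_mono) (simp add: algebra_simps)
    finally show ?thesis .
  qed
qed (simp add: potential_upto_0)

lemma renewal_submultiplicative:
  assumes "s \<ge> 0" "t \<ge> 0"
  shows "renewal M (s + t) \<le> (2 + emeasure M UNIV) * (renewal M s * renewal M t)"
proof -
  let ?m = "emeasure M UNIV"
  have "renewal M (s + t) \<le> renewal M s + (1 + ?m * renewal M s) * renewal M t"
    unfolding fun_cong[OF renewal_def, of M "s + t"]
  proof (rule potential_leI)
    fix N
    let ?u = "potential_upto M N (indicator {0..})"
    have "?u (s + t) \<le> ?u s + (1 + ?m * ?u s) * renewal M t"
      by (rule renewal_submultiplicative_aux) fact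
    also have "\<dots> \<le> renewal M s + (1 + ?m * renewal M s) * renewal M t"
      by (intro add_mono mult_right_mono mult_left_mono order_refl)
         (auto simp: renewal_def intro!: potential_upto_le)
    finally show "?u (s + t) \<le> renewal M s + (1 + ?m * renewal M s) * renewal M t" .
  qed
  \<comment> \<open>Both factors are at least 1, so the lone summands are absorbed into the product;
    this is the 2 in the constant.\<close>
  also have "\<dots> \<le> renewal M s * renewal M t + (renewal M s + ?m * renewal M s) * renewal M t"
    using mult_left_mono[OF renewal_ge_1[OF \<open>t \<ge> 0\<close>], of "renewal M s"] renewal_ge_1[OF \<open>s \<ge> 0\<close>]
    by (intro add_mono mult_right_mono) auto
  also have "\<dots> = (2 + ?m) * (renewal M s * renewal M t)"
    by (simp add: algebra_simps flip: one_add_one)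
  finally show ?thesis .
qed

end

section \<open>Exponential growth of the renewal function\<close>

lemma nn_integral_exp_Ici:
  assumes "k > 0"
  shows "(\<integral>\<^sup>+s. ennreal (exp (- k * s)) * indicator {0..} s \<partial>lborel) = ennreal (1 / k)"
proof -
  have "(\<integral>\<^sup>+s. ennreal (exp (- k * s)) * indicator {0..} s \<partial>lborel) = ennreal (0 - (- exp (- k * 0) / k))"
  proof (rule nn_integral_FTC_atLeast)
    show "((\<lambda>s. - exp (- k * s) / k) \<longlongrightarrow> 0) at_top"
      using assms by real_asymp
  qed (use assms in \<open>auto intro!: derivative_eq_intros\<close>)
  then show ?thesis by simp
qed

lemma nn_integral_cmult_exp_Ici:
  assumes "k > 0"
  shows "(\<integral>\<^sup>+s. c * (ennreal (exp (- k * s)) * indicator {0..} s) \<partial>lborel) = c * ennreal (1 / k)"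
proof -
  have "(\<integral>\<^sup>+s. c * (ennreal (exp (- k * s)) * indicator {0..} s) \<partial>lborel)
    = c * (\<integral>\<^sup>+s. ennreal (exp (- k * s)) * indicator {0..} s \<partial>lborel)"
    by (rule nn_integral_cmult) measurable
  then show ?thesis
    by (simp only: nn_integral_exp_Ici[OF assms])
qed

context finite_borel_measure
begin

text \<open>The half-line is covered by the windows \<open>((k - 1) * h, k * h]\<close>, where
  \<open>k = 0\<close> catches the point 0. By translation invariance each further window costs a
  factor \<open>exp (- t * h)\<close>, and the geometric series gives the constant.\<close>

lemma renewal_le_of_potential_Ioc:
  assumes "h > 0" "t > 0"
    and le: "\<And>s. potential M (indicator {0<..h}) s \<le> D * ennreal (exp (t * s))"
  shows "renewal M s \<le> D * ennreal (exp (t * h) / (1 - exp (- t * h))) * ennreal (exp (t * s))"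
proof -
  let ?I = "indicator {0<..h} :: real \<Rightarrow> ennreal"
  have "renewal M s \<le> potential M (\<lambda>s. \<Sum>k. ?I (s + (h - real k * h))) s"
    unfolding renewal_def
  proof (rule potential_mono)
    fix s :: real
    show "indicator {0..} s \<le> (\<Sum>k. ?I (s + (h - real k * h)))"
    proof (cases "s \<ge> 0")
      case True
      define k where "k = nat \<lceil>s / h\<rceil>"
      have "real k < s / h + 1 \<and> s / h \<le> real k"
        using True assms unfolding k_def by (simp add: ceiling_less_iff) linarith
      then have "?I (s + (h - real k * h)) = 1"
        using assms by (auto simp: field_simps)
      then have "1 = (\<Sum>k\<in>{k}. ?I (s + (h - real k * h)))"
        by simp
      also have "\<dots> \<le> (\<Sum>k. ?I (s + (h - real k * h)))"
        by (intro sum_le_suminf) auto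
      finally show ?thesis using True by simp
    qed simp
  qed
  also have "\<dots> = (\<Sum>k. potential M ?I (s + (h - real k * h)))"
    by (subst potential_suminf) (simp_all add: potential_shift)
  also have "\<dots> \<le> (\<Sum>k. D * ennreal (exp (t * (s + (h - real k * h)))))"
    by (intro suminf_le le) auto
  also have "\<dots> = (\<Sum>k. (D * ennreal (exp (t * h)) * ennreal (exp (t * s))) * ennreal (exp (- t * h) ^ k))"
    by (intro suminf_cong)
       (simp add: mult.assoc ennreal_mult[symmetric] exp_of_nat_mult[symmetric] exp_add[symmetric] algebra_simps)
  also have "\<dots> = (D * ennreal (exp (t * h)) * ennreal (exp (t * s))) * ennreal (1 / (1 - exp (- t * h)))"
    using assms by (subst ennreal_suminf_cmult, subst suminf_ennreal2) (auto simp: suminf_geometric summable_geometric)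
  also have "\<dots> = D * ennreal (exp (t * h) / (1 - exp (- t * h))) * ennreal (exp (t * s))"
    using assms by (simp add: mult.assoc ennreal_mult[symmetric] field_simps)
  finally show ?thesis .
qed

text \<open>On \<open>{0..}\<close> itself the hypothesis of the maximum principle would be the
  claim. On the window \<open>{0<..1}\<close> the potential is at most \<open>renewal M 1\<close>
  and the exponential at least 1; the windows are then summed.\<close>

lemma renewal_exp_bound:
  assumes "t > 0" "lap M t \<le> 1"
  shows "renewal M s \<le> renewal M 1 * ennreal (exp t / (1 - exp (- t))) * ennreal (exp (t * s))"
proof -
  have "potential M (indicator {0<..1}) s \<le> renewal M 1 * ennreal (exp (t * s))" for s
  proof (rule potential_max_principle)
    show "step M (\<lambda>s. ennreal (exp (t * s))) s \<le> ennreal (exp (t * s))" for s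
      using mult_left_mono[OF assms(2), of "ennreal (exp (t * s))"] by (simp add: step_exp)
  next
    fix s :: real assume "indicator {0<..1} s \<noteq> (0::ennreal)"
    then have s: "0 < s" "s \<le> 1" by (auto split: split_indicator_asm)
    have "potential M (indicator {0<..1}) s \<le> renewal M s"
      unfolding renewal_def by (intro potential_mono) (auto split: split_indicator)
    also have "\<dots> \<le> renewal M 1 * 1"
      using s by (simp add: mono_renewal)
    also have "\<dots> \<le> renewal M 1 * ennreal (exp (t * s))"
      using s assms by (intro mult_left_mono) (auto simp: ennreal_1[symmetric] simp del: ennreal_1)
    finally show "potential M (indicator {0<..1}) s \<le> renewal M 1 * ennreal (exp (t * s))" .
  qed auto
  from renewal_le_of_potential_Ioc[OF _ assms(1) this] show ?thesis by simp
qed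

text \<open>
  The exponent \<open>t\<close> is the exponential growth rate of the renewal function. By submultiplicativity the
  one-sided Laplace transform of the renewal function diverges at its abscissa \<open>t\<close>, so the boundary
  terms in the transformed renewal inequality are negligible as the argument decreases to \<open>t\<close>.
\<close>

lemma renewal_exponent:
  assumes fin: "\<And>s. renewal M s < \<infinity>"
  obtains t c where "t \<ge> 0" "lap M t \<le> 1" "c > 0"
    "\<And>s. s \<ge> 0 \<Longrightarrow> ennreal (c * exp (t * s)) \<le> renewal M s"
proof -
  define U where "U s = enn2real (renewal M s)" for s
  have U: "renewal M s = ennreal (U s)" for s
    using fin[of s] by (simp add: U_def)
  define C where "C = 2 + measure M UNIV"
  have C: "C \<ge> 1" "(2 + emeasure M UNIV) = ennreal C"
    by (auto simp: C_def emeasure_eq_measure ennreal_plus[symmetric] simp del: ennreal_plus) (simp add: ennreal_plus)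
  have U_nonneg: "U s \<ge> 0" for s by (simp add: U_def)
  have U_mono: "U s \<le> U t" if "s \<le> t" for s t
    using mono_renewal[OF that] U_nonneg by (simp add: U)
  have U1: "U s \<ge> 1" if "s \<ge> 0" for s
    using renewal_ge_1[OF that] U_nonneg by (simp add: U ennreal_1[symmetric] del: ennreal_1)
  have U_sub: "U (s + t) \<le> C * (U s * U t)" if "s \<ge> 0" "t \<ge> 0" for s t
    using renewal_submultiplicative[OF that] U_nonneg C(1)
    by (simp add: U C(2) ennreal_mult[symmetric])
  have CU: "C * U s \<ge> 1" if "s \<ge> 0" for s
    using mult_mono[OF C(1) U1[OF that]] C(1) by simp
  \<comment> \<open>\<open>C * U\<close> is submultiplicative without a constant, so Fekete's
    argument applies to its logarithm. Taking the rate as an infimum gives the lower bound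
    \<open>exp (l * s) \<le> C * U s\<close> at once.\<close>
  define \<Lambda> where "\<Lambda> s = ln (C * U s) / s" for s
  have \<Lambda>: "C * U s = exp (\<Lambda> s * s)" "\<Lambda> s \<ge> 0" if "s > 0" for s
    using that CU[of s] by (auto simp: \<Lambda>_def)
  define l where "l = Inf (\<Lambda> ` {0<..})"
  have bdd: "bdd_below (\<Lambda> ` {0<..})"
    using \<Lambda>(2) by (intro bdd_belowI[of _ 0]) auto
  have l0: "l \<ge> 0"
    unfolding l_def using \<Lambda>(2) by (intro cINF_greatest) auto
  have lower: "exp (l * s) \<le> C * U s" if "s \<ge> 0" for s
  proof (cases "s = 0")
    case False
    then have "l \<le> \<Lambda> s"
      unfolding l_def using that by (intro cINF_lower bdd) auto
    then show ?thesis
      using \<Lambda>(1)[of s] False that by (simp add: mult_right_mono)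
  qed (use CU[of 0] in simp)
  define L where "L k = (\<integral>\<^sup>+s. renewal M s * ennreal (exp (- k * s)) * indicator {0..} s \<partial>lborel)" for k
  have L_fin: "L k < \<infinity>" if "k > l" for k
  proof -
    \<comment> \<open>One \<open>s1\<close> with rate below \<open>k\<close> is enough: iterating
      submultiplicativity along its multiples and rounding \<open>s\<close> up to the next multiple
      bounds \<open>U s\<close> by a constant times \<open>exp (?p * s)\<close> with
      \<open>?p < k\<close>.\<close>
    have "\<exists>x\<in>\<Lambda> ` {0<..}. x < k"
      using that unfolding l_def by (intro cInf_lessD) auto
    then obtain s1 where s1: "s1 > 0" "\<Lambda> s1 < k"
      by auto
    let ?p = "\<Lambda> s1"
    have pow: "C * U (real (Suc n) * s1) \<le> exp (?p * s1 * real (Suc n))" for n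
    proof (induction n)
      case 0
      then show ?case using \<Lambda>(1)[OF s1(1)] by simp
    next
      case (Suc n)
      have "C * U (real (Suc (Suc n)) * s1) = C * U (real (Suc n) * s1 + s1)"
        by (simp add: algebra_simps)
      also have "\<dots> \<le> C * (C * (U (real (Suc n) * s1) * U s1))"
        using s1 C by (intro mult_left_mono U_sub) auto
      also have "\<dots> = (C * U (real (Suc n) * s1)) * (C * U s1)"
        by simp
      also have "\<dots> \<le> exp (?p * s1 * real (Suc n)) * exp (?p * s1)"
        using \<Lambda>(1)[OF s1(1)] C U_nonneg by (intro mult_mono Suc) auto
      also have "\<dots> = exp (?p * s1 * real (Suc (Suc n)))"
        by (simp add: exp_add[symmetric] algebra_simps)
      finally show ?case .
    qed
    have upper: "U s \<le> exp (?p * s1) * exp (?p * s)" if "s \<ge> 0" for s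
    proof -
      define n where "n = nat \<lfloor>s / s1\<rfloor>"
      have n: "real n \<le> s / s1" "s / s1 \<le> real (Suc n)"
        using that s1 by (simp_all add: n_def) linarith
      have "U s \<le> U (real (Suc n) * s1)"
        using n(2) s1 by (intro U_mono) (simp add: field_simps)
      also have "\<dots> \<le> C * U (real (Suc n) * s1)"
        using mult_right_mono[OF C(1) U_nonneg[of "real (Suc n) * s1"]] by simp
      also note pow
      also have "exp (?p * s1 * real (Suc n)) \<le> exp (?p * s1 * (s / s1 + 1))"
        using n(1) s1 \<Lambda>(2)[of s1] by (subst exp_le_cancel_iff, intro mult_left_mono) auto
      also have "\<dots> = exp (?p * s1) * exp (?p * s)"
        using s1 by (simp add: exp_add[symmetric] field_simps)
      finally show ?thesis .
    qed
    have "L k \<le> (\<integral>\<^sup>+s. ennreal (exp (?p * s1)) * (ennreal (exp (- (k - ?p) * s)) * indicator {0..} s) \<partial>lborel)"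
      unfolding L_def
    proof (intro nn_integral_mono)
      fix s :: real
      have "U s * exp (- k * s) \<le> exp (?p * s1) * exp (- (k - ?p) * s)" if "s \<ge> 0"
      proof -
        have "U s * exp (- k * s) \<le> exp (?p * s1) * exp (?p * s) * exp (- k * s)"
          by (intro mult_right_mono upper that) auto
        then show ?thesis by (simp add: exp_add[symmetric] algebra_simps)
      qed
      then show "renewal M s * ennreal (exp (- k * s)) * indicator {0..} s
        \<le> ennreal (exp (?p * s1)) * (ennreal (exp (- (k - ?p) * s)) * indicator {0..} s)"
        using U_nonneg[of s] by (auto simp: U ennreal_mult[symmetric] split: split_indicator)
    qed
    also have "\<dots> = ennreal (exp (?p * s1)) * ennreal (1 / (k - ?p))"
      using s1 by (intro nn_integral_cmult_exp_Ici) simp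
    also have "\<dots> < \<infinity>"
      by (simp add: ennreal_mult_less_top)
    finally show ?thesis .
  qed
  have L_lower: "ennreal (1 / (C * (k - l))) \<le> L k" if "k > l" for k
  proof -
    have "ennreal (1 / (C * (k - l))) = ennreal (1 / C) * ennreal (1 / (k - l))"
      using that C by (simp add: ennreal_mult[symmetric])
    also have "\<dots> = (\<integral>\<^sup>+s. ennreal (1 / C) * (ennreal (exp (- (k - l) * s)) * indicator {0..} s) \<partial>lborel)"
      using that by (intro nn_integral_cmult_exp_Ici[symmetric]) simp
    also have "\<dots> \<le> L k"
      unfolding L_def
    proof (intro nn_integral_mono)
      fix s :: real
      have "1 / C * exp (- (k - l) * s) \<le> U s * exp (- k * s)" if "s \<ge> 0"
      proof -
        have "exp (l * s) * exp (- k * s) \<le> C * U s * exp (- k * s)"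
          by (intro mult_right_mono lower that) auto
        then show ?thesis
          using C(1) by (simp add: exp_add[symmetric] divide_le_eq algebra_simps)
      qed
      then show "ennreal (1 / C) * (ennreal (exp (- (k - l) * s)) * indicator {0..} s)
        \<le> renewal M s * ennreal (exp (- k * s)) * indicator {0..} s"
        using U_nonneg[of s] C(1) by (auto simp: U ennreal_mult[symmetric] split: split_indicator)
    qed
    finally show ?thesis .
  qed
  \<comment> \<open>Integrate \<open>step M (renewal M) \<le> renewal M\<close> against
    \<open>exp (- k * s)\<close> over \<open>s \<ge> 0\<close> and substitute \<open>s - y\<close>.
    For \<open>y > 0\<close> the part on the negative axis is dropped. For \<open>y < 0\<close> the
    interval \<open>[0, - y)\<close> is lost, whose contribution is at most its length times
    \<open>U (- y)\<close>.\<close>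
  have key: "(\<integral>\<^sup>+y. ennreal (exp (- k * y)) * (L k - ennreal (max 0 (- y) * U (max 0 (- y)))) \<partial>M) \<le> L k"
    if "k > l" for k
  proof -
    define g where "g s = renewal M s * ennreal (exp (- k * s))" for s
    have [measurable]: "g \<in> borel_measurable borel"
      unfolding g_def by measurable
    have tail: "L k - ennreal (z * U z) \<le> (\<integral>\<^sup>+s. g s * indicator {z..} s \<partial>lborel)" if "z \<ge> 0" for z
    proof -
      have "L k = (\<integral>\<^sup>+s. g s * indicator {0..<z} s + g s * indicator {z..} s \<partial>lborel)"
        unfolding L_def g_def using that by (intro nn_integral_cong) (auto split: split_indicator)
      also have "\<dots> = (\<integral>\<^sup>+s. g s * indicator {0..<z} s \<partial>lborel) + (\<integral>\<^sup>+s. g s * indicator {z..} s \<partial>lborel)"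
        by (intro nn_integral_add) auto
      also have "(\<integral>\<^sup>+s. g s * indicator {0..<z} s \<partial>lborel) \<le> (\<integral>\<^sup>+s. ennreal (U z) * indicator {0..<z} s \<partial>lborel)"
      proof (intro nn_integral_mono)
        fix s
        have "U s * exp (- k * s) \<le> U z * 1" if "0 \<le> s" "s \<le> z"
          using that \<open>k > l\<close> l0 U_nonneg by (intro mult_mono U_mono) auto
        then show "g s * indicator {0..<z} s \<le> ennreal (U z) * indicator {0..<z} s"
          using U_nonneg by (auto simp: g_def U ennreal_mult[symmetric] split: split_indicator)
      qed
      also have "\<dots> = ennreal (z * U z)"
        using that U_nonneg by (simp add: nn_integral_cmult_indicator ennreal_mult[symmetric] mult.commute)
      finally have "L k \<le> ennreal (z * U z) + (\<integral>\<^sup>+s. g s * indicator {z..} s \<partial>lborel)"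
        by (simp add: add_right_mono)
      then show ?thesis
        by (subst ennreal_minus_le_iff) auto
    qed
    interpret P: pair_sigma_finite M lborel ..
    have "(\<integral>\<^sup>+y. ennreal (exp (- k * y)) * (L k - ennreal (max 0 (- y) * U (max 0 (- y)))) \<partial>M)
      \<le> (\<integral>\<^sup>+y. ennreal (exp (- k * y)) * (\<integral>\<^sup>+s. g s * indicator {max 0 (- y)..} s \<partial>lborel) \<partial>M)"
      by (intro nn_integral_mono mult_left_mono tail) auto
    also have "\<dots> \<le> (\<integral>\<^sup>+y. (\<integral>\<^sup>+s. renewal M (s - y) * ennreal (exp (- k * s)) * indicator {0..} s \<partial>lborel) \<partial>M)"
    proof (intro nn_integral_mono)
      fix y
      have "ennreal (exp (- k * y)) * (\<integral>\<^sup>+s. g s * indicator {max 0 (- y)..} s \<partial>lborel)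
        \<le> ennreal (exp (- k * y)) * (\<integral>\<^sup>+s. g s * indicator {- y..} s \<partial>lborel)"
        by (intro mult_left_mono nn_integral_mono) (auto split: split_indicator)
      also have "\<dots> = (\<integral>\<^sup>+s. ennreal (exp (- k * y)) * (g s * indicator {- y..} s) \<partial>lborel)"
        by (subst nn_integral_cmult) auto
      also have "\<dots> = (\<integral>\<^sup>+s. renewal M s * ennreal (exp (- k * (s + y))) * indicator {0..} (s + y) \<partial>lborel)"
        by (intro nn_integral_cong)
           (auto simp: g_def U U_nonneg ennreal_mult[symmetric] exp_add[symmetric] algebra_simps split: split_indicator)
      also have "\<dots> = (\<integral>\<^sup>+s. renewal M (s - y) * ennreal (exp (- k * s)) * indicator {0..} s \<partial>lborel)"
        by (subst nn_integral_real_affine[where c = 1 and t = "- y"]) auto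
      finally show "ennreal (exp (- k * y)) * (\<integral>\<^sup>+s. g s * indicator {max 0 (- y)..} s \<partial>lborel)
        \<le> (\<integral>\<^sup>+s. renewal M (s - y) * ennreal (exp (- k * s)) * indicator {0..} s \<partial>lborel)" .
    qed
    also have "\<dots> = (\<integral>\<^sup>+s. (\<integral>\<^sup>+y. renewal M (s - y) * ennreal (exp (- k * s)) * indicator {0..} s \<partial>M) \<partial>lborel)"
      by (rule P.Fubini'[symmetric]) measurable
    also have "\<dots> = (\<integral>\<^sup>+s. step M (renewal M) s * (ennreal (exp (- k * s)) * indicator {0..} s) \<partial>lborel)"
      unfolding step_def by (intro nn_integral_cong) (simp add: nn_integral_multc mult.assoc)
    also have "\<dots> \<le> L k"
      unfolding L_def
    proof (intro nn_integral_mono)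
      fix s
      have "step M (renewal M) s \<le> renewal M s"
        by (subst renewal_eq[of s]) simp
      then show "step M (renewal M) s * (ennreal (exp (- k * s)) * indicator {0..} s)
        \<le> renewal M s * ennreal (exp (- k * s)) * indicator {0..} s"
        unfolding mult.assoc by (intro mult_right_mono) auto
    qed
    finally show ?thesis .
  qed
  define k where "k n = l + 1 / real (Suc n)" for n
  define K where "K n = enn2real (L (k n))" for n
  have kl: "k n > l" for n by (simp add: k_def)
  have K: "L (k n) = ennreal (K n)" for n
    using L_fin[OF kl] by (simp add: K_def)
  have K_ge: "K n \<ge> real (Suc n) / C" for n
  proof -
    have "ennreal (1 / (C * (k n - l))) \<le> ennreal (K n)"
      using L_lower[OF kl, of n] by (simp only: K)
    then have "1 / (C * (k n - l)) \<le> K n"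
      by (subst (asm) ennreal_le_iff) (simp add: K_def)
    then show ?thesis by (simp add: k_def)
  qed
  have K_pos: "K n > 0" for n
    by (rule less_le_trans[OF _ K_ge]) (use C in auto)
  have K_top: "filterlim K at_top sequentially"
  proof (rule filterlim_at_top_mono)
    show "filterlim (\<lambda>n. real (Suc n) / C) at_top sequentially"
      using C by real_asymp
  qed (use K_ge in auto)
  \<comment> \<open>The integrand of \<open>key\<close> divided by \<open>K n\<close>. Where the
    bracket is negative, \<open>ennreal\<close> sends it to 0, in agreement with the truncated
    subtraction in \<open>key\<close>.\<close>
  define F where "F n y = ennreal (exp (- k n * y) * (1 - max 0 (- y) * U (max 0 (- y)) / K n))" for n y
  have U_meas [measurable]: "U \<in> borel_measurable borel"
    unfolding U_def by measurable
  have F_meas [measurable]: "F n \<in> borel_measurable borel" for n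
    unfolding F_def by measurable
  have F_le: "(\<integral>\<^sup>+y. F n y \<partial>M) \<le> 1" for n
  proof -
    have "ennreal (K n) * (\<integral>\<^sup>+y. F n y \<partial>M) = (\<integral>\<^sup>+y. ennreal (K n) * F n y \<partial>M)"
      by (subst nn_integral_cmult) auto
    also have "\<dots> = (\<integral>\<^sup>+y. ennreal (exp (- k n * y)) * (L (k n) - ennreal (max 0 (- y) * U (max 0 (- y)))) \<partial>M)"
    proof (intro nn_integral_cong)
      fix y
      have "ennreal (K n) * F n y = ennreal (exp (- k n * y) * (K n - max 0 (- y) * U (max 0 (- y))))"
      proof -
        have *: "K n * (e * (1 - w / K n)) = e * (K n - w)" for e w
          using K_pos[of n] by (simp add: right_diff_distrib)
        show ?thesis
          unfolding F_def using K_pos[of n] by (subst ennreal_mult'[symmetric]) (simp_all only: * less_imp_le)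
      qed
      then show "ennreal (K n) * F n y
          = ennreal (exp (- k n * y)) * (L (k n) - ennreal (max 0 (- y) * U (max 0 (- y))))"
        using U_nonneg[of "max 0 (- y)"] by (simp only: K ennreal_minus ennreal_mult'[OF exp_ge_zero] mult_nonneg_nonneg max.cobounded1)
    qed
    also have "\<dots> \<le> ennreal (K n) * 1"
      using key[OF kl, of n] by (simp add: K)
    finally show ?thesis
      by (subst (asm) ennreal_mult_le_mult_iff) (use K_pos[of n] in auto)
  qed
  \<comment> \<open>Fatou's lemma is used because \<open>lap M\<close> is not known to be finite at
    the exponents \<open>k n\<close>, so no dominating function is at hand.\<close>
  have "lap M l = (\<integral>\<^sup>+y. liminf (\<lambda>n. F n y) \<partial>M)"
    unfolding laplace_def
  proof (intro nn_integral_cong)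
    fix y
    have k_lim: "k \<longlonglongrightarrow> l"
      unfolding k_def[abs_def] by real_asymp
    have "(\<lambda>n. max 0 (- y) * U (max 0 (- y)) / K n) \<longlonglongrightarrow> 0"
      by (rule real_tendsto_divide_at_top[OF tendsto_const K_top])
    then have "(\<lambda>n. F n y) \<longlonglongrightarrow> ennreal (exp (- l * y) * (1 - 0))"
      unfolding F_def by (intro tendsto_intros tendsto_ennrealI k_lim)
    then show "ennreal (exp (- l * y)) = liminf (\<lambda>n. F n y)"
      using lim_imp_Liminf[OF sequentially_bot] by fastforce
  qed
  also have "\<dots> \<le> liminf (\<lambda>n. \<integral>\<^sup>+y. F n y \<partial>M)"
    by (rule nn_integral_liminf) simp
  also have "\<dots> \<le> liminf (\<lambda>n. 1 :: ennreal)"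
    using F_le by (intro Liminf_mono) auto
  also have "\<dots> = 1"
    by (simp add: Liminf_const)
  finally have "lap M l \<le> 1" .
  moreover have "ennreal (1 / C * exp (l * s)) \<le> renewal M s" if "s \<ge> 0" for s
    using lower[OF that] C(1) by (auto simp: U intro!: ennreal_leI simp: field_simps)
  ultimately show ?thesis
    using that[of l "1 / C"] l0 C by auto
qed

end

section \<open>The slope of the Laplace transform at the minimal root\<close>

lemma exp_difference_quotient_mono:
  fixes y :: real
  assumes "0 < a" "a \<le> b"
  shows "(exp (a * y) - 1) / a \<le> (exp (b * y) - 1) / b"
proof -
  have "exp ((1 - a / b) *\<^sub>R 0 + (a / b) *\<^sub>R (b * y)) \<le> (1 - a / b) * exp 0 + (a / b) * exp (b * y)"
    using assms by (intro convex_onD[OF exp_convex]) auto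
  then have "exp (a * y) - 1 \<le> a * ((exp (b * y) - 1) / b)"
    using assms by (simp add: algebra_simps diff_divide_distrib)
  then show ?thesis
    using assms by (simp add: divide_le_eq mult.commute)
qed

text \<open>The majorant does not depend on \<open>t\<close>. The constant 1 is written
  \<open>exp (- 0 * y)\<close> so that integration yields \<open>lap M 0\<close>.\<close>

lemma exp_neg_mult_le:
  fixes t g y :: real
  assumes "0 \<le> t" "t \<le> g"
  shows "exp (- t * y) \<le> exp (- 0 * y) + exp (- g * y)"
proof (cases "y \<ge> 0")
  case True
  then have "exp (- t * y) \<le> 1" using assms by auto
  then show ?thesis by (simp add: add_increasing2)
next
  case False
  then have "exp (- t * y) \<le> exp (- g * y)" using assms by (auto simp: mult_right_mono_neg)
  then show ?thesis by (simp add: add_increasing)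
qed

context finite_borel_measure
begin

lemma lap_le:
  assumes "0 \<le> t" "t \<le> g"
  shows "lap M t \<le> lap M 0 + lap M g"
proof -
  have "lap M t \<le> (\<integral>\<^sup>+y. ennreal (exp (- 0 * y)) + ennreal (exp (- g * y)) \<partial>M)"
    unfolding laplace_def
  proof (intro nn_integral_mono)
    fix y
    show "ennreal (exp (- t * y)) \<le> ennreal (exp (- 0 * y)) + ennreal (exp (- g * y))"
      using ennreal_leI[OF exp_neg_mult_le[OF assms]] by simp
  qed
  also have "\<dots> = lap M 0 + lap M g"
    unfolding laplace_def by (rule nn_integral_add) auto
  finally show ?thesis .
qed

lemma lap_0: "lap M 0 = emeasure M UNIV"
  using sets_eq_imp_space_eq[OF sets_eq] by (simp add: laplace_def)

lemma lap_finite: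
  assumes "0 \<le> t" "t \<le> g" "lap M g < \<infinity>"
  shows "lap M t < \<infinity>"
  using lap_le[OF assms(1,2)] assms(3) by (auto simp: lap_0 emeasure_eq_measure intro: le_less_trans)

lemma lap_integral:
  assumes "0 \<le> t" "t \<le> g" "lap M g < \<infinity>"
  shows "integrable M (\<lambda>y. exp (- t * y))" "(\<integral>y. exp (- t * y) \<partial>M) = enn2real (lap M t)"
  using lap_finite[OF assms] by (auto simp: laplace_def integral_eq_nn_integral intro!: integrableI_nonneg)

lemma step_scale: "h \<in> borel_measurable borel \<Longrightarrow> step (density M (\<lambda>_. r)) h s = r * step M h s"
  unfolding step_def by (subst nn_integral_density) (auto simp: nn_integral_cmult)

lemma lap_scale: "lap (density M (\<lambda>_. r)) t = r * lap M t"
  unfolding laplace_def by (subst nn_integral_density) (auto simp: nn_integral_cmult)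

lemma finite_borel_measure_scale:
  assumes "r < \<infinity>"
  shows "finite_borel_measure (density M (\<lambda>_. r))"
proof (intro finite_borel_measure.intro finite_borel_measure_axioms.intro finite_measureI)
  show "emeasure (density M (\<lambda>_. r)) (space (density M (\<lambda>_. r))) \<noteq> \<infinity>"
    using assms by (simp add: emeasure_density_const ennreal_mult_eq_top_iff)
qed (simp add: M_is_borel)

text \<open>The renewal function of the larger measure is a supersolution for the smaller
  one.\<close>

lemma renewal_scale_le:
  assumes "r \<le> 1"
  shows "renewal (density M (\<lambda>_. r)) s \<le> renewal M s"
proof -
  interpret N: finite_borel_measure "density M (\<lambda>_. r)"
    using assms by (intro finite_borel_measure_scale) (auto intro: le_less_trans)
  show ?thesis
    unfolding renewal_def[of "density M (\<lambda>_. r)"]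
  proof (rule N.potential_le_supersolution)
    fix s
    have "r * step M (renewal M) s \<le> 1 * step M (renewal M) s"
      using assms by (intro mult_right_mono) auto
    then show "indicator {0..} s + step (density M (\<lambda>_. r)) (renewal M) s \<le> renewal M s"
      by (subst renewal_eq[of s]) (simp add: step_scale add_left_mono)
  qed simp
qed

text \<open>Over the whole line, rather than over \<open>{0..}\<close>, the convolution becomes a
  product with no boundary term. The identity holds in \<open>ennreal\<close> also when
  \<open>L\<close> is infinite.\<close>

lemma laplace_renewal_eq:
  assumes "k > 0"
  defines "L \<equiv> \<integral>\<^sup>+s. renewal M s * ennreal (exp (- k * s)) \<partial>lborel"
  shows "L = ennreal (1 / k) + lap M k * L"
proof -
  interpret P: pair_sigma_finite M lborel ..
  have "L = (\<integral>\<^sup>+s. ennreal (exp (- k * s)) * indicator {0..} s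
      + step M (renewal M) s * ennreal (exp (- k * s)) \<partial>lborel)"
    unfolding L_def by (subst renewal_eq) (simp add: algebra_simps)
  also have "\<dots> = ennreal (1 / k) + (\<integral>\<^sup>+s. step M (renewal M) s * ennreal (exp (- k * s)) \<partial>lborel)"
    using nn_integral_exp_Ici[OF assms(1)] by (subst nn_integral_add) auto
  also have "(\<integral>\<^sup>+s. step M (renewal M) s * ennreal (exp (- k * s)) \<partial>lborel)
      = (\<integral>\<^sup>+s. (\<integral>\<^sup>+y. renewal M (s - y) * ennreal (exp (- k * s)) \<partial>M) \<partial>lborel)"
    unfolding step_def by (intro nn_integral_cong) (simp add: nn_integral_multc)
  also have "\<dots> = (\<integral>\<^sup>+y. (\<integral>\<^sup>+s. renewal M (s - y) * ennreal (exp (- k * s)) \<partial>lborel) \<partial>M)"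
    by (rule P.Fubini') measurable
  also have "\<dots> = (\<integral>\<^sup>+y. ennreal (exp (- k * y)) * L \<partial>M)"
  proof (intro nn_integral_cong)
    fix y
    have "(\<integral>\<^sup>+s. renewal M (s - y) * ennreal (exp (- k * s)) \<partial>lborel)
        = (\<integral>\<^sup>+s. renewal M s * ennreal (exp (- k * (y + s))) \<partial>lborel)"
      by (subst nn_integral_real_affine[where c = 1 and t = y]) auto
    also have "\<dots> = (\<integral>\<^sup>+s. ennreal (exp (- k * y)) * (renewal M s * ennreal (exp (- k * s))) \<partial>lborel)"
    proof (intro nn_integral_cong)
      fix s
      have "ennreal (exp (- k * (y + s))) = ennreal (exp (- k * y)) * ennreal (exp (- k * s))"
        by (simp add: ennreal_mult[symmetric] exp_add[symmetric] algebra_simps)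
      then show "renewal M s * ennreal (exp (- k * (y + s)))
          = ennreal (exp (- k * y)) * (renewal M s * ennreal (exp (- k * s)))"
        by (simp only: mult_ac)
    qed
    also have "\<dots> = ennreal (exp (- k * y)) * L"
      unfolding L_def by (rule nn_integral_cmult) measurable
    finally show "(\<integral>\<^sup>+s. renewal M (s - y) * ennreal (exp (- k * s)) \<partial>lborel) = ennreal (exp (- k * y)) * L" .
  qed
  also have "\<dots> = lap M k * L"
    unfolding laplace_def by (rule nn_integral_multc) measurable
  finally show ?thesis .
qed

text \<open>The smaller exponent \<open>t\<close> controls the right half-line and the larger
  exponent \<open>g\<close> the left one; both integrals converge because \<open>k\<close> lies
  strictly between.\<close>

lemma laplace_renewal_le:
  assumes "t < k" "k < g" "D \<ge> 0"
    and le: "\<And>s. renewal M s \<le> ennreal (D * exp (t * s))" "\<And>s. renewal M s \<le> ennreal (D * exp (g * s))"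
  shows "(\<integral>\<^sup>+s. renewal M s * ennreal (exp (- k * s)) \<partial>lborel) \<le> ennreal (D * (1 / (k - t) + 1 / (g - k)))"
proof -
  let ?e = "\<lambda>c s. ennreal (exp (- c * s)) * indicator {0..} s :: ennreal"
  have "(\<integral>\<^sup>+s. renewal M s * ennreal (exp (- k * s)) \<partial>lborel)
      \<le> (\<integral>\<^sup>+s. ennreal D * ?e (k - t) s + ennreal D * ?e (g - k) (- s) \<partial>lborel)"
  proof (intro nn_integral_mono)
    fix s :: real
    show "renewal M s * ennreal (exp (- k * s)) \<le> ennreal D * ?e (k - t) s + ennreal D * ?e (g - k) (- s)"
    proof (cases "s \<ge> 0")
      case True
      have "renewal M s * ennreal (exp (- k * s)) \<le> ennreal (D * exp (t * s)) * ennreal (exp (- k * s))"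
        by (intro mult_right_mono le) auto
      also have "\<dots> = ennreal D * ?e (k - t) s"
        using True \<open>D \<ge> 0\<close> by (simp add: ennreal_mult[symmetric] exp_add[symmetric] algebra_simps)
      finally show ?thesis by (simp add: add_increasing2)
    next
      case False
      have "renewal M s * ennreal (exp (- k * s)) \<le> ennreal (D * exp (g * s)) * ennreal (exp (- k * s))"
        by (intro mult_right_mono le) auto
      also have "\<dots> = ennreal D * ?e (g - k) (- s)"
        using False \<open>D \<ge> 0\<close> by (simp add: ennreal_mult[symmetric] exp_add[symmetric] algebra_simps)
      finally show ?thesis by (simp add: add_increasing)
    qed
  qed
  also have "\<dots> = ennreal D * (\<integral>\<^sup>+s. ?e (k - t) s \<partial>lborel) + ennreal D * (\<integral>\<^sup>+s. ?e (g - k) (- s) \<partial>lborel)"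
    by (simp add: nn_integral_add nn_integral_cmult)
  also have "(\<integral>\<^sup>+s. ?e (g - k) (- s) \<partial>lborel) = (\<integral>\<^sup>+s. ?e (g - k) s \<partial>lborel)"
    by (subst (2) nn_integral_real_affine[where c = "-1" and t = 0]) auto
  also have "ennreal D * (\<integral>\<^sup>+s. ?e (k - t) s \<partial>lborel) + ennreal D * (\<integral>\<^sup>+s. ?e (g - k) s \<partial>lborel)
      = ennreal D * ennreal (1 / (k - t)) + ennreal D * ennreal (1 / (g - k))"
    using assms by (simp only: nn_integral_exp_Ici diff_gt_0_iff_gt)
  also have "\<dots> = ennreal (D * (1 / (k - t) + 1 / (g - k)))"
    using assms by (simp add: ennreal_mult[symmetric] ennreal_plus[symmetric] distrib_left del: ennreal_plus)
  finally show ?thesis .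
qed

text \<open>
  For \<open>t < g\<close> normalise the measure by \<open>lap M t\<close>. The renewal functions of the normalised measures are
  bounded by multiples of \<open>exp (t * s)\<close> and \<open>exp (g * s)\<close> with one constant, so at the midpoint of
  \<open>t\<close> and \<open>g\<close> their Laplace transform is of order \<open>1 / (g - t)\<close>. The transformed renewal equation
  turns this into a lower bound for the slope.
\<close>

lemma lap_slope_at_root:
  assumes fin: "\<And>s. renewal M s < \<infinity>"
    and g: "g > 0" "lap M g = 1" and minimal: "\<And>t. 0 \<le> t \<Longrightarrow> t < g \<Longrightarrow> lap M t > 1"
  obtains c where "c > 0" "\<And>t. g / 2 \<le> t \<Longrightarrow> t < g \<Longrightarrow> c * (g - t) \<le> enn2real (lap M t) - 1"
proof -
  \<comment> \<open>The constant of \<open>renewal_exp_bound\<close>, made uniform over exponents in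
    \<open>[g / 2, g]\<close>: the numerator is taken at \<open>g\<close>, the denominator at
    \<open>g / 2\<close>.\<close>
  define D where "D = enn2real (renewal M 1) * (exp g / (1 - exp (- g / 2)))"
  have r1: "renewal M 1 = ennreal (enn2real (renewal M 1))" "enn2real (renewal M 1) \<ge> 1"
    using fin[of 1] renewal_ge_1[of 1]
    by (auto simp: enn2real_positive_iff intro!: enn2real_leI) (metis enn2real_1 enn2real_mono infinity_ennreal_def)
  have D: "D > 0"
    unfolding D_def using r1(2) g by (intro mult_pos_pos divide_pos_pos) auto
  have bound: "renewal N s \<le> ennreal (D * exp (t * s))"
    if "finite_borel_measure N" "lap N t = 1" "g / 2 \<le> t" "t \<le> g" "renewal N 1 \<le> renewal M 1" for N t s
  proof -
    have "renewal N s \<le> renewal N 1 * ennreal (exp t / (1 - exp (- t))) * ennreal (exp (t * s))"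
      using that g by (intro finite_borel_measure.renewal_exp_bound) auto
    also have "\<dots> \<le> renewal M 1 * ennreal (exp g / (1 - exp (- g / 2))) * ennreal (exp (t * s))"
      using that g by (intro mult_mono ennreal_leI divide_mono) (auto intro: diff_left_mono)
    also have "\<dots> = ennreal (D * exp (t * s))"
    proof -
      have "exp g / (1 - exp (- g / 2)) \<ge> 0" using g by simp
      then show ?thesis
        unfolding D_def by (subst r1(1)) (simp only: ennreal_mult enn2real_nonneg mult_nonneg_nonneg exp_ge_zero)
    qed
    finally show ?thesis .
  qed
  show ?thesis
  proof
    \<comment> \<open>The distance from the midpoint to either end is \<open>(g - t) / 2\<close>, so
      the transform is at most \<open>4 * D / (g - t)\<close>; the remaining \<open>1 / g\<close> is
      a lower bound for \<open>f t / k\<close>.\<close>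
    show "1 / (4 * D * g) > 0" using D g by simp
    fix t assume t: "g / 2 \<le> t" "t < g"
    define f where "f s = enn2real (lap M s)" for s
    have f: "lap M s = ennreal (f s)" if "0 \<le> s" "s \<le> g" for s
      using lap_finite[OF that] g by (simp add: f_def)
    define k where "k = (t + g) / 2"
    have k: "t < k" "k < g" "0 < k" using t g by (auto simp: k_def)
    have f_gt: "f s > 1" if "0 \<le> s" "s < g" for s
    proof -
      have "ennreal 1 < ennreal (f s)"
        using minimal[OF that] f[of s] that by simp
      then show ?thesis
        by (rule ennreal_less_iff[THEN iffD1, rotated]) simp
    qed
    have ft: "f t > 1" and fk: "f k > 1"
      using t k g by (auto intro!: f_gt)
    define N where "N = density M (\<lambda>_. ennreal (1 / f t))"
    interpret N: finite_borel_measure N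
      unfolding N_def by (rule finite_borel_measure_scale) simp
    have rN: "renewal N s \<le> renewal M s" for s
      unfolding N_def using ft by (intro renewal_scale_le) simp
    have lapN: "lap N s = ennreal (f s / f t)" if "0 \<le> s" "s \<le> g" for s
      unfolding N_def lap_scale f[OF that] using ft enn2real_nonneg[of "lap M s"]
      by (simp add: ennreal_mult[symmetric] f_def)
    have b1: "renewal N s \<le> ennreal (D * exp (t * s))" for s
    proof (rule bound)
      show "lap N t = 1" using t ft g by (subst lapN) auto
    qed (use t rN N.finite_borel_measure_axioms in auto)
    \<comment> \<open>The exponent \<open>g\<close> is inherited from \<open>M\<close>, where it is
      critical, since scaling down by \<open>1 / f t < 1\<close> only decreases the renewal
      function.\<close>
    have b2: "renewal N s \<le> ennreal (D * exp (g * s))" for s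
      by (rule order_trans[OF rN], rule bound) (use g finite_borel_measure_axioms in auto)
    define L where "L = (\<integral>\<^sup>+s. renewal N s * ennreal (exp (- k * s)) \<partial>lborel)"
    have "L \<le> ennreal (D * (1 / (k - t) + 1 / (g - k)))"
      unfolding L_def using k D b1 b2 by (intro N.laplace_renewal_le) auto
    also have "D * (1 / (k - t) + 1 / (g - k)) = 4 * D / (g - t)"
    proof -
      have *: "k - t = (g - t) / 2" "g - k = (g - t) / 2"
        by (simp_all add: k_def field_simps)
      show ?thesis unfolding * by (simp add: add_divide_distrib[symmetric])
    qed
    finally have L_le: "L \<le> ennreal (4 * D / (g - t))" .
    define z where "z = enn2real L"
    have z: "L = ennreal z" "z \<ge> 0"
      using L_le by (auto simp: z_def intro!: ennreal_enn2real[symmetric]) (metis ennreal_less_top le_less_trans)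
    have z_le: "z \<le> 4 * D / (g - t)"
      using L_le z D t by (simp add: ennreal_le_iff)
    have "L = ennreal (1 / k) + lap N k * L"
      unfolding L_def by (rule N.laplace_renewal_eq) fact
    then have "ennreal z = ennreal (1 / k + f k / f t * z)"
      using k ft fk z by (simp add: lapN ennreal_mult[symmetric] ennreal_plus[symmetric] del: ennreal_plus)
    then have "z = 1 / k + f k / f t * z"
      using k ft fk z by (subst (asm) ennreal_inj) auto
    then have eq: "z * (f t - f k) = f t / k"
      using ft k by (simp add: field_simps)
    have "1 / g \<le> f t / k"
      using ft k g by (intro frac_le) auto
    then have *: "1 / g \<le> z * (f t - f k)"
      by (simp add: eq)
    have pos: "f t - f k > 0"
      using * z(2) g by (smt (verit) divide_pos_pos mult_nonneg_nonpos)
    have "1 / g \<le> 4 * D / (g - t) * (f t - f k)"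
      using * mult_right_mono[OF z_le, of "f t - f k"] pos by linarith
    then have "1 / (4 * D * g) * (g - t) \<le> f t - f k"
      using D g t by (simp add: field_simps)
    \<comment> \<open>The midpoint still lies left of the minimal root, so
      \<open>f k > 1\<close>.\<close>
    also have "\<dots> \<le> f t - 1" using fk by simp
    finally show "1 / (4 * D * g) * (g - t) \<le> enn2real (lap M t) - 1"
      by (simp add: f_def)
  qed
qed

text \<open>Difference quotients are taken from the left, where the transform is finite. By
  convexity of \<open>exp\<close> they are monotone, and the slope bound keeps their integrals below
  \<open>- c\<close>, so monotone convergence gives both integrability of the limit and the
  sign.\<close>

lemma tilted_mean_pos_of_renewal_finite:
  assumes fin: "\<And>s. renewal M s < \<infinity>"
    and g: "g > 0" "lap M g = 1" and minimal: "\<And>t. 0 \<le> t \<Longrightarrow> t < g \<Longrightarrow> lap M t > 1"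
  shows "tilted_mean M (\<lambda>y. y) g > 0"
proof -
  obtain c where c: "c > 0" "\<And>t. g / 2 \<le> t \<Longrightarrow> t < g \<Longrightarrow> c * (g - t) \<le> enn2real (lap M t) - 1"
    using lap_slope_at_root[OF assms] by blast
  have "lap M g < \<infinity>" using g by simp
  note int = lap_integral[OF _ _ this]
  \<comment> \<open>The 2 in the denominator keeps \<open>g - h n\<close> in
    \<open>[g / 2, g)\<close>, the range of the slope bound.\<close>
  define h where "h n = g / real (n + 2)" for n
  have h: "0 < h n" "h n \<le> g / 2" for n
    using g by (auto simp: h_def field_simps)
  have h_dec: "h n \<le> h m" if "m \<le> n" for m n
    using g that by (auto simp: h_def intro!: divide_left_mono)
  define X where "X n y = (exp (- g * y) - exp (- (g - h n) * y)) / h n" for n y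
  have X_eq: "X n y = - (exp (- g * y) * ((exp (h n * y) - 1) / h n))" for n y
    by (simp add: X_def algebra_simps exp_diff exp_add exp_minus divide_simps)
  have X_int: "integrable M (X n)" for n
    unfolding X_def using h[of n] g by (intro integrable_divide Bochner_Integration.integrable_diff int) auto
  have X_le: "integral\<^sup>L M (X n) \<le> - c" for n
  proof -
    have "integral\<^sup>L M (X n) = (1 - enn2real (lap M (g - h n))) / h n"
    proof -
      have "integral\<^sup>L M (X n) = ((\<integral>y. exp (- g * y) \<partial>M) - (\<integral>y. exp (- (g - h n) * y) \<partial>M)) / h n"
        unfolding X_def integral_divide_zero
        by (subst Bochner_Integration.integral_diff[OF int(1) int(1)]) (use h[of n] g in auto)
      also have "(\<integral>y. exp (- g * y) \<partial>M) = 1"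
        by (subst int(2)) (use g in auto)
      also have "(\<integral>y. exp (- (g - h n) * y) \<partial>M) = enn2real (lap M (g - h n))"
        by (rule int(2)) (use h[of n] g in auto)
      finally show ?thesis .
    qed
    also have "\<dots> \<le> - c"
      using c(2)[of "g - h n"] h[of n] by (simp add: field_simps)
    finally show ?thesis .
  qed
  have X_mono: "mono (\<lambda>n. X n y)" for y
  proof (rule monoI)
    fix m n :: nat assume "m \<le> n"
    have "exp (- g * y) * ((exp (h n * y) - 1) / h n) \<le> exp (- g * y) * ((exp (h m * y) - 1) / h m)"
      using \<open>m \<le> n\<close> h by (intro mult_left_mono exp_difference_quotient_mono h_dec) auto
    then show "X m y \<le> X n y" by (simp add: X_eq)
  qed
  have X_lim: "(\<lambda>n. X n y) \<longlonglongrightarrow> - (y * exp (- g * y))" for y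
  proof -
    have "((\<lambda>x. exp (x * y)) has_real_derivative y) (at 0)"
      by (auto intro!: derivative_eq_intros)
    then have "((\<lambda>x. (exp (x * y) - 1) / x) \<longlongrightarrow> y) (at 0)"
      by (simp add: has_field_derivative_iff)
    moreover have "filterlim h (at 0) sequentially"
    proof (rule filterlim_atI)
      show "h \<longlonglongrightarrow> 0" unfolding h_def[abs_def] by real_asymp
    qed (use h in \<open>auto intro!: always_eventually simp: less_imp_neq[symmetric]\<close>)
    ultimately have "(\<lambda>n. (exp (h n * y) - 1) / h n) \<longlonglongrightarrow> y"
      by (rule filterlim_compose)
    then have "(\<lambda>n. - (exp (- g * y) * ((exp (h n * y) - 1) / h n))) \<longlonglongrightarrow> - (exp (- g * y) * y)"
      by (intro tendsto_intros)
    then show ?thesis by (simp add: X_eq mult.commute)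
  qed
  have "incseq (\<lambda>n. integral\<^sup>L M (X n))"
    using X_mono by (intro monoI integral_mono X_int) (auto dest: monoD)
  then obtain x where x: "(\<lambda>n. integral\<^sup>L M (X n)) \<longlonglongrightarrow> x"
    using X_le incseq_convergent by blast
  have "x \<le> - c"
    by (rule LIMSEQ_le_const2[OF x]) (use X_le in auto)
  moreover have "integral\<^sup>L M (\<lambda>y. - (y * exp (- g * y))) = x"
    by (rule integral_monotone_convergence[OF X_int _ _ x]) (use X_mono X_lim in auto)
  ultimately show ?thesis
    using c(1) by (simp add: tilted_mean_def)
qed

end

section \<open>Transience under positive drift\<close>

text \<open>
  \<open>hit \<nu> s\<close> is the probability that the walk started at \<open>s\<close> ever takes a positive value.
\<close>

definition climb :: "real measure \<Rightarrow> (real \<Rightarrow> ennreal) \<Rightarrow> real \<Rightarrow> ennreal" where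
  "climb \<nu> w s = (if 0 < s then 1 else step \<nu> w s)"

definition hit_upto :: "real measure \<Rightarrow> nat \<Rightarrow> real \<Rightarrow> ennreal" where
  "hit_upto \<nu> N = (climb \<nu> ^^ N) (indicator {0<..})"

definition hit :: "real measure \<Rightarrow> real \<Rightarrow> ennreal" where
  "hit \<nu> s = (SUP N. hit_upto \<nu> N s)"

context finite_borel_measure
begin

lemma hit_upto_0: "hit_upto M 0 s = indicator {0<..} s"
  by (simp add: hit_upto_def)

lemma hit_upto_Suc: "hit_upto M (Suc N) s = (if 0 < s then 1 else step M (hit_upto M N) s)"
  by (simp add: hit_upto_def climb_def)

lemma measurable_hit_upto [measurable]: "hit_upto M N \<in> borel_measurable borel"
proof (induction N)
  case 0
  then show ?case by (simp add: hit_upto_def)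
next
  case (Suc N)
  note [measurable] = Suc
  show ?case unfolding hit_upto_Suc[abs_def] by measurable
qed

lemma measurable_hit [measurable]: "hit M \<in> borel_measurable borel"
  unfolding hit_def[abs_def] by measurable

lemma hit_upto_pos: "0 < s \<Longrightarrow> hit_upto M N s = 1"
  by (cases N) (simp_all add: hit_upto_0 hit_upto_Suc)

lemma hit_upto_le_Suc: "hit_upto M N s \<le> hit_upto M (Suc N) s"
proof (induction N arbitrary: s)
  case 0
  then show ?case by (simp add: hit_upto_0 hit_upto_Suc indicator_def)
next
  case (Suc N)
  show ?case
    using step_mono[OF Suc] by (subst (1 2) hit_upto_Suc) simp
qed

lemma incseq_hit_upto: "incseq (\<lambda>N. hit_upto M N s)"
  by (rule incseq_SucI) (rule hit_upto_le_Suc)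

lemma hit_upto_le_1:
  assumes "emeasure M UNIV = 1"
  shows "hit_upto M N s \<le> 1"
proof (induction N arbitrary: s)
  case 0
  then show ?case by (simp add: hit_upto_0 indicator_def)
next
  case (Suc N)
  have "step M (hit_upto M N) s \<le> step M (\<lambda>_. 1) s"
    by (intro step_mono Suc)
  then show ?case
    using assms by (simp add: hit_upto_Suc step_const)
qed

lemma mono_hit_upto:
  assumes "emeasure M UNIV = 1"
  shows "mono (hit_upto M N)"
proof (induction N)
  case 0
  then show ?case by (auto intro!: monoI simp: hit_upto_0 indicator_def)
next
  case (Suc N)
  show ?case
  proof (rule monoI)
    fix s t :: real assume "s \<le> t"
    then have "step M (hit_upto M N) s \<le> step M (hit_upto M N) t"
      using mono_step[OF Suc] by (auto dest: monoD)
    then show "hit_upto M (Suc N) s \<le> hit_upto M (Suc N) t"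
      using \<open>s \<le> t\<close> hit_upto_le_1[OF assms, of "Suc N"] by (auto simp: hit_upto_Suc)
  qed
qed

lemma hit_le_1: "emeasure M UNIV = 1 \<Longrightarrow> hit M s \<le> 1"
  unfolding hit_def by (intro SUP_least hit_upto_le_1)

lemma mono_hit: "emeasure M UNIV = 1 \<Longrightarrow> s \<le> t \<Longrightarrow> hit M s \<le> hit M t"
  unfolding hit_def by (intro SUP_mono) (auto intro: monoD mono_hit_upto)

lemma hit_pos: "0 < s \<Longrightarrow> hit M s = 1"
  unfolding hit_def by (simp add: hit_upto_pos)

lemma hit_nonpos:
  assumes "s \<le> 0"
  shows "hit M s = step M (hit M) s"
proof -
  have "step M (hit M) s = (SUP N. step M (hit_upto M N) s)"
    unfolding step_def hit_def using incseq_hit_upto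
    by (subst nn_integral_monotone_convergence_SUP[symmetric]) (auto simp: incseq_def le_fun_def)
  also have "\<dots> = (SUP N. hit_upto M (Suc N) s)"
    using assms by (simp add: hit_upto_Suc)
  also have "\<dots> = hit M s"
    unfolding hit_def using LIMSEQ_unique[OF LIMSEQ_SUP LIMSEQ_Suc[OF LIMSEQ_SUP[OF incseq_hit_upto]]]
    by (simp add: LIMSEQ_SUP LIMSEQ_unique incseq_SucI hit_upto_le_Suc)
  finally show ?thesis by simp
qed

lemma measurable_hit_upto_mass [measurable]:
  "(\<lambda>y. \<integral>\<^sup>+s. hit_upto M N s * indicator {- y<..0} s \<partial>lborel) \<in> borel_measurable M"
  by (simp only: indicator_def greaterThanAtMost_iff, measurable)

text \<open>
  A form of the maximal ergodic lemma. The mass of \<open>hit_upto M N\<close> on the negative half-line grows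
  with \<open>N\<close>, so what one step removes from it cannot exceed what the negative part of the step supplies.
\<close>

lemma hit_upto_balance:
  assumes prob: "emeasure M UNIV = 1" and int: "(\<integral>\<^sup>+y. ennreal (- y) \<partial>M) < \<infinity>"
  shows "(\<integral>\<^sup>+y. (\<integral>\<^sup>+s. hit_upto M N s * indicator {- y<..0} s \<partial>lborel) \<partial>M) \<le> (\<integral>\<^sup>+y. ennreal (- y) \<partial>M)"
proof -
  interpret P: pair_sigma_finite M lborel ..
  define A where "A N = (\<integral>\<^sup>+s. hit_upto M N s * indicator {..0} s \<partial>lborel)" for N
  define B where "B N = (\<integral>\<^sup>+y. (\<integral>\<^sup>+s. hit_upto M N s * indicator {- y<..0} s \<partial>lborel) \<partial>M)" for N
  \<comment> \<open>Compare for fixed \<open>y\<close>. If \<open>y \<ge> 0\<close>, then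
    \<open>{..- y}\<close> and \<open>{- y<..0}\<close> make up \<open>{..0}\<close>. If
    \<open>y < 0\<close>, then \<open>{..- y}\<close> exceeds \<open>{..0}\<close> by an interval of
    length \<open>- y\<close> on which \<open>hit_upto\<close> equals 1, and the second set is
    empty.\<close>
  have A_Suc: "A (Suc N) + B N = A N + (\<integral>\<^sup>+y. ennreal (- y) \<partial>M)" for N
  proof -
    have "A (Suc N) = (\<integral>\<^sup>+s. (\<integral>\<^sup>+y. hit_upto M N (s - y) * indicator {..0} s \<partial>M) \<partial>lborel)"
      unfolding A_def
      by (intro nn_integral_cong) (auto simp: hit_upto_Suc step_def nn_integral_multc split: split_indicator)
    also have "\<dots> = (\<integral>\<^sup>+y. (\<integral>\<^sup>+s. hit_upto M N (s - y) * indicator {..0} s \<partial>lborel) \<partial>M)"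
      by (rule P.Fubini') measurable
    also have "\<dots> = (\<integral>\<^sup>+y. (\<integral>\<^sup>+s. hit_upto M N s * indicator {..- y} s \<partial>lborel) \<partial>M)"
    proof (rule nn_integral_cong)
      fix y :: real
      have "(\<integral>\<^sup>+s. hit_upto M N (s - y) * indicator {..0} s \<partial>lborel)
        = (\<integral>\<^sup>+s. hit_upto M N s * indicator {..0} (y + s) \<partial>lborel)"
        by (subst nn_integral_real_affine[where c = 1 and t = y]) auto
      also have "\<dots> = (\<integral>\<^sup>+s. hit_upto M N s * indicator {..- y} s \<partial>lborel)"
        by (intro nn_integral_cong) (auto split: split_indicator)
      finally show "(\<integral>\<^sup>+s. hit_upto M N (s - y) * indicator {..0} s \<partial>lborel)
        = (\<integral>\<^sup>+s. hit_upto M N s * indicator {..- y} s \<partial>lborel)" .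
    qed
    finally have A_eq: "A (Suc N) = (\<integral>\<^sup>+y. (\<integral>\<^sup>+s. hit_upto M N s * indicator {..- y} s \<partial>lborel) \<partial>M)" .
    have [measurable]: "(\<lambda>y. \<integral>\<^sup>+s. hit_upto M N s * indicator {..- y} s \<partial>lborel) \<in> borel_measurable M"
      by (simp only: indicator_def atMost_iff, measurable)
    have "A (Suc N) + B N = (\<integral>\<^sup>+y. (\<integral>\<^sup>+s. hit_upto M N s * indicator {..- y} s \<partial>lborel)
        + (\<integral>\<^sup>+s. hit_upto M N s * indicator {- y<..0} s \<partial>lborel) \<partial>M)"
      unfolding A_eq B_def by (subst nn_integral_add) simp_all
    also have "\<dots> = (\<integral>\<^sup>+y. A N + ennreal (- y) \<partial>M)"
    proof (intro nn_integral_cong)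
      fix y :: real
      show "(\<integral>\<^sup>+s. hit_upto M N s * indicator {..- y} s \<partial>lborel)
        + (\<integral>\<^sup>+s. hit_upto M N s * indicator {- y<..0} s \<partial>lborel) = A N + ennreal (- y)"
      proof (cases "y \<ge> 0")
        case True
        have "(\<integral>\<^sup>+s. hit_upto M N s * indicator {..- y} s \<partial>lborel)
            + (\<integral>\<^sup>+s. hit_upto M N s * indicator {- y<..0} s \<partial>lborel)
            = (\<integral>\<^sup>+s. hit_upto M N s * indicator {..- y} s + hit_upto M N s * indicator {- y<..0} s \<partial>lborel)"
          by (subst nn_integral_add) auto
        also have "\<dots> = A N"
          unfolding A_def using True by (intro nn_integral_cong) (auto split: split_indicator)
        finally show ?thesis
          using True by (simp add: ennreal_neg)
      next
        case False
        have "(\<integral>\<^sup>+s. hit_upto M N s * indicator {..- y} s \<partial>lborel)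
            = (\<integral>\<^sup>+s. hit_upto M N s * indicator {..0} s + indicator {0<..- y} s \<partial>lborel)"
          using False by (intro nn_integral_cong) (auto simp: hit_upto_pos split: split_indicator)
        also have "\<dots> = A N + ennreal (- y)"
          unfolding A_def using False by (subst nn_integral_add) auto
        finally show ?thesis
          using False by simp
      qed
    qed
    also have "\<dots> = A N + (\<integral>\<^sup>+y. ennreal (- y) \<partial>M)"
      using prob sets_eq_imp_space_eq[OF sets_eq] by (subst nn_integral_add) auto
    finally show ?thesis .
  qed
  \<comment> \<open>Finiteness permits cancelling \<open>A N\<close> below. It starts from
    \<open>A 0 = 0\<close>, because \<open>hit_upto M 0\<close> vanishes on \<open>{..0}\<close>,
    and one step adds at most the mean of the negative part.\<close>
  have A_fin: "A N < \<infinity>" for N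
  proof (induction N)
    case 0
    have "A 0 = (\<integral>\<^sup>+(s::real). 0 \<partial>lborel)"
      unfolding A_def by (intro nn_integral_cong) (auto simp: hit_upto_0 split: split_indicator)
    then show ?case by simp
  next
    case (Suc N)
    have "A (Suc N) \<le> A (Suc N) + B N" by simp
    also have "\<dots> < \<infinity>"
      unfolding A_Suc using Suc int by simp
    finally show ?case .
  qed
  have "A N + B N \<le> A (Suc N) + B N"
    unfolding A_def by (intro add_right_mono nn_integral_mono mult_right_mono hit_upto_le_Suc) auto
  then have "A N + B N \<le> A N + (\<integral>\<^sup>+y. ennreal (- y) \<partial>M)"
    by (simp only: A_Suc)
  then show ?thesis
    using A_fin[of N] unfolding B_def[symmetric] by (auto simp: ennreal_add_left_cancel_le)
qed

text \<open>The positive part of \<open>y\<close> is the length of \<open>{- y<..0}\<close>. If the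
  walk surely returned from every \<open>- t\<close> that a jump can overshoot, inserting
  \<open>hit\<close> into this length would change nothing after Fubini, and
  \<open>hit_upto_balance\<close> would bound the mean of the positive part by that of the negative
  part.\<close>

lemma ex_escape_of_mean_pos:
  assumes prob: "emeasure M UNIV = 1" and int: "integrable M (\<lambda>y. y)" and pos: "(\<integral>y. y \<partial>M) > 0"
  obtains t where "t \<ge> 0" "emeasure M {t<..} > 0" "hit M (- t) < 1"
proof (rule ccontr)
  assume no: "\<not> thesis"
  note escape = that
  have one: "hit M (- t) = 1" if "t \<ge> 0" "emeasure M {t<..} \<noteq> 0" for t
    using escape[of t] that no hit_le_1[OF prob, of "- t"] by (auto simp: less_le zero_less_iff_neq_zero)
  interpret P: pair_sigma_finite M lborel ..
  have fin: "(\<integral>\<^sup>+y. ennreal (- y) \<partial>M) < \<infinity>" "(\<integral>\<^sup>+y. ennreal y \<partial>M) < \<infinity>"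
    using int by (auto simp: real_integrable_def less_top)
  have "(\<integral>\<^sup>+y. ennreal y \<partial>M) = (\<integral>\<^sup>+y. (\<integral>\<^sup>+s. indicator {- y<..0} s \<partial>lborel) \<partial>M)"
    by (intro nn_integral_cong, rename_tac y, case_tac "0 \<le> y") (simp_all add: ennreal_neg)
  also have "\<dots> = (\<integral>\<^sup>+s. (\<integral>\<^sup>+y. indicator {- y<..0} s \<partial>M) \<partial>lborel)"
    by (rule P.Fubini'[symmetric]) (measurable, simp add: indicator_def)
  also have "\<dots> = (\<integral>\<^sup>+s. (\<integral>\<^sup>+y. hit M s * indicator {- y<..0} s \<partial>M) \<partial>lborel)"
  proof (rule nn_integral_cong)
    fix s :: real
    have *: "(\<integral>\<^sup>+y. indicator {- y<..0} s \<partial>M) = indicator {..0} s * emeasure M {- s<..}"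
    proof -
      have "(\<integral>\<^sup>+y. indicator {- y<..0} s \<partial>M) = (\<integral>\<^sup>+y. indicator {..0} s * indicator {- s<..} y \<partial>M)"
        by (intro nn_integral_cong) (auto split: split_indicator)
      then show ?thesis
        by (simp add: nn_integral_cmult)
    qed
    have "(\<integral>\<^sup>+y. hit M s * indicator {- y<..0} s \<partial>M) = hit M s * (\<integral>\<^sup>+y. indicator {- y<..0} s \<partial>M)"
      by (rule nn_integral_cmult) (simp add: indicator_def)
    then show "(\<integral>\<^sup>+y. indicator {- y<..0} s \<partial>M) = (\<integral>\<^sup>+y. hit M s * indicator {- y<..0} s \<partial>M)"
      using one[of "- s"] by (cases "emeasure M {- s<..} = 0") (auto simp: * split: split_indicator)
  qed
  also have "\<dots> = (\<integral>\<^sup>+y. (\<integral>\<^sup>+s. hit M s * indicator {- y<..0} s \<partial>lborel) \<partial>M)"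
    by (rule P.Fubini') (measurable, simp add: indicator_def)
  also have "\<dots> = (\<integral>\<^sup>+y. (SUP N. \<integral>\<^sup>+s. hit_upto M N s * indicator {- y<..0} s \<partial>lborel) \<partial>M)"
    unfolding hit_def SUP_mult_right_ennreal
    using incseq_hit_upto
    by (intro nn_integral_cong nn_integral_monotone_convergence_SUP)
       (auto simp: incseq_def le_fun_def intro!: mult_right_mono)
  also have "\<dots> = (SUP N. \<integral>\<^sup>+y. (\<integral>\<^sup>+s. hit_upto M N s * indicator {- y<..0} s \<partial>lborel) \<partial>M)"
    using incseq_hit_upto
    by (intro nn_integral_monotone_convergence_SUP)
       (auto simp: incseq_def le_fun_def intro!: mult_right_mono nn_integral_mono)
  also have "\<dots> \<le> (\<integral>\<^sup>+y. ennreal (- y) \<partial>M)"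
    by (intro SUP_least hit_upto_balance prob fin)
  finally have "enn2real (\<integral>\<^sup>+y. ennreal y \<partial>M) \<le> enn2real (\<integral>\<^sup>+y. ennreal (- y) \<partial>M)"
    using fin by (intro enn2real_mono) auto
  then show False
    using pos by (simp add: real_lebesgue_integral_def[OF int])
qed

text \<open>From a point of \<open>{0<..h}\<close>, where \<open>hit\<close> is 1, a jump of size at
  least \<open>t + h\<close> leads to \<open>{..- t}\<close>, where \<open>hit\<close> is at most
  \<open>q < 1\<close>. The deficit is therefore at least
  \<open>(1 - q) * measure M {t + h..}\<close>, and \<open>h\<close> is chosen to make that mass
  positive.\<close>

lemma ex_strict_supersolution_of_mean_pos:
  assumes prob: "emeasure M UNIV = 1" and int: "integrable M (\<lambda>y. y)" and pos: "(\<integral>y. y \<partial>M) > 0"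
  obtains d h where "d > 0" "h > 0"
    "\<And>s. step M (hit M) s + ennreal d * indicator {0<..h} s \<le> hit M s"
proof -
  obtain t where t: "t \<ge> 0" "emeasure M {t<..} > 0" "hit M (- t) < 1"
    using ex_escape_of_mean_pos[OF assms] by blast
  have "\<exists>n. emeasure M {t + 1 / real (Suc n)..} \<noteq> 0"
  proof (rule ccontr)
    assume "\<not> ?thesis"
    then have "emeasure M (\<Union>n. {t + 1 / real (Suc n)..}) = 0"
      by (intro emeasure_UN_eq_0) auto
    moreover have "{t<..} \<subseteq> (\<Union>n. {t + 1 / real (Suc n)..})"
    proof
      fix x assume "x \<in> {t<..}"
      then obtain n where "1 / real (Suc n) < x - t"
        using nat_approx_posE[of "x - t"] by auto
      then show "x \<in> (\<Union>n. {t + 1 / real (Suc n)..})"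
        by (auto intro!: exI[of _ n])
    qed
    ultimately have "emeasure M {t<..} = 0"
      using emeasure_mono[of "{t<..}" "\<Union>n. {t + 1 / real (Suc n)..}" M] by auto
    then show False using t(2) by simp
  qed
  then obtain h where h: "h > 0" "emeasure M {t + h..} \<noteq> 0"
    by (metis divide_pos_pos of_nat_0_less_iff zero_less_Suc zero_less_one)
  define q where "q = enn2real (hit M (- t))"
  have q: "hit M (- t) = ennreal q" "0 \<le> q" "q < 1"
    using t(3) by (cases "hit M (- t)"; auto simp: q_def ennreal_less_one_iff)+
  define d where "d = (1 - q) * measure M {t + h..}"
  have d: "d > 0"
    using q h(2) by (auto simp: d_def emeasure_eq_measure zero_less_measure_iff)
  show ?thesis
  proof
    fix s :: real
    show "step M (hit M) s + ennreal d * indicator {0<..h} s \<le> hit M s"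
    proof (cases "0 < s")
      case False
      then show ?thesis by (simp add: hit_nonpos)
    next
      case True
      have "step M (hit M) s + ennreal d * indicator {0<..h} s
          \<le> (\<integral>\<^sup>+y. hit M (s - y) + ennreal (1 - q) * indicator {t + h..} y * indicator {0<..h} s \<partial>M)"
        using q(3) by (subst nn_integral_add)
          (auto simp: step_def d_def nn_integral_cmult nn_integral_multc ennreal_mult emeasure_eq_measure)
      also have "\<dots> \<le> (\<integral>\<^sup>+y. 1 \<partial>M)"
      proof (intro nn_integral_mono)
        fix y
        show "hit M (s - y) + ennreal (1 - q) * indicator {t + h..} y * indicator {0<..h} s \<le> 1"
        proof (cases "t + h \<le> y \<and> s \<le> h")
          case True
          then have "hit M (s - y) \<le> ennreal q"
            unfolding q(1)[symmetric] by (intro mono_hit prob) auto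
          then have "hit M (s - y) + ennreal (1 - q) \<le> ennreal q + ennreal (1 - q)"
            by (rule add_right_mono)
          also have "\<dots> = 1"
            using q by (simp add: ennreal_plus[symmetric] del: ennreal_plus)
          finally show ?thesis
            using True \<open>0 < s\<close> by simp
        next
          case False
          then have *: "ennreal (1 - q) * indicator {t + h..} y * indicator {0<..h} s = 0"
            by (auto split: split_indicator)
          show ?thesis
            unfolding * using hit_le_1[OF prob] by simp
        qed
      qed
      also have "\<dots> = hit M s"
        using True prob sets_eq_imp_space_eq[OF sets_eq] by (simp add: hit_pos)
      finally show ?thesis .
    qed
  qed (use d h in auto)
qed

lemma renewal_finite_of_tilted_mean_pos:
  assumes g: "g > 0" "lap M g = 1" and pos: "tilted_mean M (\<lambda>y. y) g > 0"
  shows "renewal M s < \<infinity>"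
proof -
  define Q where "Q = density M (\<lambda>y. ennreal (exp (- g * y)))"
  have Q_UNIV: "emeasure Q UNIV = 1"
    using g(2) sets_eq_imp_space_eq[OF sets_eq]
    unfolding Q_def by (subst emeasure_density) (auto simp: laplace_def)
  interpret Q: finite_borel_measure Q
  proof (intro finite_borel_measure.intro finite_borel_measure_axioms.intro finite_measureI)
    show "emeasure Q (space Q) \<noteq> \<infinity>"
      using Q_UNIV sets_eq_imp_space_eq[OF sets_eq] by (simp add: Q_def)
  qed (simp add: Q_def M_is_borel)
  \<comment> \<open>A non-integrable function has Bochner integral 0, so a positive value implies
    integrability.\<close>
  have "integrable M (\<lambda>y. y * exp (- g * y))"
    using pos not_integrable_integral_eq[of M "\<lambda>y. y * exp (- g * y)"] by (auto simp: tilted_mean_def)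
  then have "integrable Q (\<lambda>y. y)" "(\<integral>y. y \<partial>Q) > 0"
    using pos unfolding Q_def tilted_mean_def
    by (auto simp: integrable_real_density integral_real_density mult.commute)
  then obtain d h where dh: "d > 0" "h > 0"
    "\<And>s. step Q (hit Q) s + ennreal d * indicator {0<..h} s \<le> hit Q s"
    using Q.ex_strict_supersolution_of_mean_pos[OF Q_UNIV] by blast
  \<comment> \<open>Doob transform: multiplication by \<open>exp (g * s)\<close> turns
    \<open>step Q\<close> back into \<open>step M\<close>, and \<open>exp (g * s) \<ge> 1\<close> on
    \<open>{0<..h}\<close>, so dividing by the deficit \<open>d\<close> yields a supersolution for
    the window.\<close>
  define W where "W s = ennreal (1 / d) * (ennreal (exp (g * s)) * hit Q s)" for s
  have step_W: "step M W s = ennreal (1 / d) * (ennreal (exp (g * s)) * step Q (hit Q) s)" for s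
  proof -
    have "step M (\<lambda>s. ennreal (exp (g * s)) * hit Q s) s
      = (\<integral>\<^sup>+y. ennreal (exp (g * s)) * (ennreal (exp (- g * y)) * hit Q (s - y)) \<partial>M)"
      unfolding step_def mult.assoc[symmetric]
      by (intro nn_integral_cong) (simp add: ennreal_mult[symmetric] exp_add[symmetric] algebra_simps)
    also have "\<dots> = ennreal (exp (g * s)) * step Q (hit Q) s"
    proof -
      have *: "(\<integral>\<^sup>+y. f y \<partial>Q) = (\<integral>\<^sup>+y. ennreal (exp (- g * y)) * f y \<partial>M)"
        if "f \<in> borel_measurable borel" for f
        unfolding Q_def using that by (intro nn_integral_density) auto
      show ?thesis
        unfolding step_def by (subst *, measurable) (rule nn_integral_cmult, measurable)
    qed
    finally show ?thesis
      unfolding W_def[abs_def] by (subst step_cmult) auto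
  qed
  have "potential M (indicator {0<..h}) s \<le> ennreal (1 / d) * ennreal (exp (g * s))" for s
  proof -
    have "potential M (indicator {0<..h}) s \<le> W s"
    proof (rule potential_le_supersolution)
      fix s
      have "indicator {0<..h} s \<le> ennreal (1 / d) * (ennreal (exp (g * s)) * (ennreal d * indicator {0<..h} s))"
        using dh g by (auto simp: ennreal_mult[symmetric] ennreal_1[symmetric] simp del: ennreal_1 split: split_indicator)
      then have "indicator {0<..h} s + step M W s
        \<le> ennreal (1 / d) * (ennreal (exp (g * s)) * (step Q (hit Q) s + ennreal d * indicator {0<..h} s))"
        by (simp add: step_W distrib_left add.commute add_left_mono)
      also have "\<dots> \<le> W s"
        unfolding W_def by (intro mult_left_mono dh) auto
      finally show "indicator {0<..h} s + step M W s \<le> W s" .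
    qed simp
    also have "\<dots> \<le> ennreal (1 / d) * (ennreal (exp (g * s)) * 1)"
      unfolding W_def by (intro mult_left_mono Q.hit_le_1 Q_UNIV) auto
    finally show ?thesis by simp
  qed
  then have "renewal M s \<le> ennreal (1 / d) * ennreal (exp (g * h) / (1 - exp (- g * h))) * ennreal (exp (g * s))"
    by (rule renewal_le_of_potential_Ioc[OF dh(2) g(1)])
  also have "\<dots> < \<infinity>"
    by (simp add: ennreal_mult_less_top)
  finally show ?thesis .
qed

end

section \<open>Roots of the Laplace transform\<close>

lemma less_neg_ln_iff: "ereal a < neg_ln p \<longleftrightarrow> p < ennreal (exp (- a))"
proof (cases p)
  case (real r)
  show ?thesis
  proof (cases "r = 0")
    case False
    then have "a < - ln r \<longleftrightarrow> r < exp (- a)"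
      using real by (metis exp_less_cancel_iff exp_ln less_eq_real_def minus_less_iff neg_less_iff_less)
    then show ?thesis
      using real False by (simp add: neg_ln_def ennreal_less_iff)
  qed (simp add: neg_ln_def real)
qed (simp add: neg_ln_def top_unique)

lemma le_neg_ln_iff: "ereal a \<le> neg_ln p \<longleftrightarrow> p \<le> ennreal (exp (- a))"
proof (cases p)
  case (real r)
  show ?thesis
  proof (cases "r = 0")
    case False
    then have "a \<le> - ln r \<longleftrightarrow> r \<le> exp (- a)"
      using real by (metis exp_le_cancel_iff exp_ln less_eq_real_def minus_le_iff neg_le_iff_le)
    then show ?thesis
      using real False by (simp add: neg_ln_def ennreal_le_iff)
  qed (simp add: neg_ln_def real)
qed (simp add: neg_ln_def top_unique)

context finite_borel_measure
begin

lemma continuous_on_lap: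
  assumes "lap M g < \<infinity>"
  shows "continuous_on {0..g} (\<lambda>t. enn2real (lap M t))"
  unfolding continuous_on_sequentially
proof (intro allI ballI impI)
  fix x a assume a: "a \<in> {0..g}" and xa: "(\<forall>n. x n \<in> {0..g}) \<and> x \<longlonglongrightarrow> a"
  have "(\<lambda>n. \<integral>y. exp (- x n * y) \<partial>M) \<longlonglongrightarrow> (\<integral>y. exp (- a * y) \<partial>M)"
  proof (rule integral_dominated_convergence)
    show "integrable M (\<lambda>y. exp (- 0 * y) + exp (- g * y))"
      using a assms by (intro Bochner_Integration.integrable_add lap_integral[where g = g]) auto
    show "AE y in M. (\<lambda>n. exp (- x n * y)) \<longlonglongrightarrow> exp (- a * y)"
      using xa by (auto intro!: tendsto_intros)
    show "AE y in M. norm (exp (- x n * y)) \<le> exp (- 0 * y) + exp (- g * y)" for n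
    proof (rule AE_I2)
      fix y
      have n: "0 \<le> x n" "x n \<le> g" using xa by auto
      show "norm (exp (- x n * y)) \<le> exp (- 0 * y) + exp (- g * y)"
        using exp_neg_mult_le[OF n] by simp
    qed
  qed auto
  moreover have "(\<integral>y. exp (- t * y) \<partial>M) = enn2real (lap M t)" if "t \<in> {0..g}" for t
    using that by (intro lap_integral[OF _ _ assms]) auto
  ultimately show "((\<lambda>t. enn2real (lap M t)) \<circ> x) \<longlonglongrightarrow> enn2real (lap M a)"
    using a xa by (simp add: comp_def)
qed

text \<open>The root is the first point of the closed set where the transform is at most 1.
  Continuity is used on \<open>[0, t]\<close> only, since the transform may be infinite beyond. The
  strict inequality on all of \<open>[0, g)\<close> is what the slope bound later requires.\<close>

lemma ex_minimal_root:
  assumes t: "t \<ge> 0" "lap M t \<le> 1" and mass: "emeasure M UNIV > 1"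
  obtains g where "0 < g" "g \<le> t" "lap M g = 1" "\<And>s. 0 \<le> s \<Longrightarrow> s < g \<Longrightarrow> lap M s > 1"
proof -
  define f where "f s = enn2real (lap M s)" for s
  have t_fin: "lap M t < \<infinity>" using t(2) by (auto intro: le_less_trans)
  have f: "lap M s = ennreal (f s)" if "0 \<le> s" "s \<le> t" for s
    using lap_finite[OF that t_fin] by (simp add: f_def)
  have f_nonneg: "f s \<ge> 0" for s by (simp add: f_def)
  have cont: "continuous_on {0..t} f"
    unfolding f_def using t_fin by (rule continuous_on_lap)
  have f0: "f 0 > 1"
  proof -
    have "ennreal 1 < ennreal (f 0)"
      using mass f[of 0] t lap_0 by simp
    then show ?thesis by (rule ennreal_less_iff[THEN iffD1, rotated]) simp
  qed
  have ft: "f t \<le> 1"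
    using t f[of t] by simp
  define S where "S = {s \<in> {0..t}. f s \<le> 1}"
  have "closed ({0..t} \<inter> f -` {..1})"
    using cont by (intro continuous_closed_preimage) auto
  also have "{0..t} \<inter> f -` {..1} = S" by (auto simp: S_def)
  finally have "closed S" .
  have S: "S \<noteq> {}" "bdd_below S"
    using t ft by (auto simp: S_def intro!: bdd_belowI[of _ 0])
  define g where "g = Inf S"
  have "g \<in> S"
    unfolding g_def using S \<open>closed S\<close> by (intro closed_contains_Inf)
  then have g: "0 \<le> g" "g \<le> t" "f g \<le> 1" by (auto simp: S_def)
  have g0: "g > 0" using g f0 by (cases "g = 0") auto
  have below: "f s > 1" if "0 \<le> s" "s < g" for s
  proof (rule ccontr)
    assume "\<not> 1 < f s"
    then have "s \<in> S" using that g by (auto simp: S_def)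
    then have "g \<le> s" unfolding g_def using S by (intro cInf_lower)
    then show False using that by simp
  qed
  obtain x where x: "0 \<le> x" "x \<le> g" "f x = 1"
    using IVT2'[of f g 1 0] g f0 continuous_on_subset[OF cont, of "{0..g}"] by auto
  then have "f g = 1"
    using below[of x] by (cases "x = g") auto
  show ?thesis
  proof
    show "lap M g = 1" using f[of g] g \<open>f g = 1\<close> by simp
    show "lap M s > 1" if "0 \<le> s" "s < g" for s
    proof -
      have "ennreal 1 < ennreal (f s)"
        using below[OF that] by (intro ennreal_lessI) auto
      then show ?thesis using f[of s] that g by simp
    qed
  qed (use g g0 in auto)
qed

lemma lap_strict_antimono:
  assumes nonneg: "AE y in M. y \<ge> 0" and nz: "\<not> (AE y in M. y = 0)" and st: "0 \<le> s" "s < t"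
  shows "lap M t < lap M s"
proof -
  have fin: "lap M u < \<infinity>" if "u \<ge> 0" for u
  proof -
    have "lap M u \<le> (\<integral>\<^sup>+y. 1 \<partial>M)"
      unfolding laplace_def using nonneg that by (intro nn_integral_mono_AE) auto
    also have "\<dots> < \<infinity>" by (simp add: emeasure_eq_measure)
    finally show ?thesis .
  qed
  note int = lap_integral[OF _ order_refl fin]
  have "(\<integral>y. exp (- s * y) - exp (- t * y) \<partial>M) = enn2real (lap M s) - enn2real (lap M t)"
    using st by (subst Bochner_Integration.integral_diff[OF int(1) int(1)]) (simp_all only: int(2))
  moreover have "(\<integral>y. exp (- s * y) - exp (- t * y) \<partial>M) > 0"
  proof -
    have nn: "AE y in M. 0 \<le> exp (- s * y) - exp (- t * y)"
      using nonneg by eventually_elim (use st in \<open>auto intro!: mult_right_mono\<close>)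
    have "(\<integral>y. exp (- s * y) - exp (- t * y) \<partial>M) \<noteq> 0"
    proof
      assume "(\<integral>y. exp (- s * y) - exp (- t * y) \<partial>M) = 0"
      then have "AE y in M. exp (- s * y) - exp (- t * y) = 0"
        using st nn int(1)[of s] int(1)[of t] by (subst (asm) integral_nonneg_eq_0_iff_AE) auto
      then have "AE y in M. y = 0"
        by eventually_elim (use st in auto)
      then show False using nz by simp
    qed
    then show ?thesis
      using integral_nonneg_AE[OF nn] by simp
  qed
  ultimately have "enn2real (lap M t) < enn2real (lap M s)" by simp
  then have "ennreal (enn2real (lap M t)) < ennreal (enn2real (lap M s))"
    by (intro ennreal_lessI) (auto intro: le_less_trans[OF enn2real_nonneg])
  then show ?thesis
    using fin[of s] fin[of t] st by simp
qed

text \<open>As the exponent grows, the transform tends to the mass of the atom at 0.\<close>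

lemma ex_lap_less_1_of_atom:
  assumes nonneg: "AE y in M. y \<ge> 0" and atom: "emeasure M {0} < 1"
  obtains t where "t \<ge> 0" "lap M t < 1"
proof -
  have "(\<lambda>n. \<integral>y. exp (- real n * y) \<partial>M) \<longlonglongrightarrow> (\<integral>y. indicator {0} y \<partial>M)"
  proof (rule integral_dominated_convergence[where w = "\<lambda>_. 1"])
    show "AE y in M. (\<lambda>n. exp (- real n * y)) \<longlonglongrightarrow> indicator {0} y"
      using nonneg
    proof eventually_elim
      fix y :: real assume "y \<ge> 0"
      show "(\<lambda>n. exp (- real n * y)) \<longlonglongrightarrow> indicator {0} y"
      proof (cases "y = 0")
        case False
        then have "y > 0" using \<open>y \<ge> 0\<close> by simp
        then have "(\<lambda>n. exp (- real n * y)) \<longlonglongrightarrow> 0" by real_asymp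
        then show ?thesis using False by simp
      qed simp
    qed
    show "AE y in M. norm (exp (- real n * y)) \<le> 1" for n
      using nonneg by eventually_elim auto
  qed auto
  then have "(\<lambda>n. \<integral>y. exp (- real n * y) \<partial>M) \<longlonglongrightarrow> measure M {0}"
    by simp
  moreover have "measure M {0} < 1"
    using atom by (simp add: emeasure_eq_measure)
  ultimately have "\<forall>\<^sub>F n in sequentially. (\<integral>y. exp (- real n * y) \<partial>M) < 1"
    by (rule order_tendstoD)
  then obtain n where n: "(\<integral>y. exp (- real n * y) \<partial>M) < 1"
    by (auto simp: eventually_sequentially)
  have "lap M (real n) \<le> (\<integral>\<^sup>+y. 1 \<partial>M)"
    unfolding laplace_def using nonneg by (intro nn_integral_mono_AE) auto
  then have fin: "lap M (real n) < \<infinity>"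
    by (auto simp: emeasure_eq_measure intro: le_less_trans)
  have "lap M (real n) = ennreal (enn2real (lap M (real n)))"
    using fin by simp
  also have "\<dots> < 1"
    using n unfolding lap_integral(2)[OF of_nat_0_le_iff order_refl fin]
    by (simp add: ennreal_less_one_iff)
  finally show ?thesis
    using that[of "real n"] by simp
qed

text \<open>Staying at 0 gives \<open>renewal M 0 \<ge> 1 + emeasure M {0} * renewal M 0\<close>,
  impossible for a finite value if the atom has mass at least 1.\<close>

lemma emeasure_atom_less_1_of_renewal_finite:
  assumes "renewal M 0 < \<infinity>"
  shows "emeasure M {0} < 1"
proof (rule ccontr)
  assume "\<not> emeasure M {0} < 1"
  then have "1 * renewal M 0 \<le> emeasure M {0} * renewal M 0"
    by (intro mult_right_mono) (auto simp: not_less)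
  also have "\<dots> = (\<integral>\<^sup>+y. renewal M 0 * indicator {0} y \<partial>M)"
    by (subst nn_integral_cmult_indicator) (simp_all add: mult.commute)
  also have "\<dots> \<le> step M (renewal M) 0"
    unfolding step_def by (intro nn_integral_mono) (auto split: split_indicator)
  finally have "1 + renewal M 0 \<le> renewal M 0"
    by (subst (2) renewal_eq) (simp add: add_left_mono)
  then show False
    using assms by (cases "renewal M 0") (auto simp: ennreal_plus[symmetric] ennreal_1[symmetric] simp del: ennreal_plus ennreal_1)
qed

lemma ex_neg_mass:
  assumes "emeasure M {..<0} > 0"
  obtains d where "d > 0" "emeasure M {..- d} > 0"
proof -
  have "\<exists>n. emeasure M {..- (1 / real (Suc n))} \<noteq> 0"
  proof (rule ccontr)
    assume "\<not> ?thesis"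
    then have "emeasure M (\<Union>n. {..- (1 / real (Suc n))}) = 0"
      by (intro emeasure_UN_eq_0) auto
    moreover have "{..<0} \<subseteq> (\<Union>n. {..- (1 / real (Suc n))})"
    proof
      fix x :: real assume "x \<in> {..<0}"
      then obtain n where "1 / real (Suc n) < - x"
        using nat_approx_posE[of "- x"] by auto
      then show "x \<in> (\<Union>n. {..- (1 / real (Suc n))})"
        by (auto intro!: exI[of _ n])
    qed
    ultimately have "emeasure M {..<0} = 0"
      using emeasure_mono[of "{..<0}" "\<Union>n. {..- (1 / real (Suc n))}" M] by auto
    then show False using assms by simp
  qed
  then obtain n where "emeasure M {..- (1 / real (Suc n))} \<noteq> 0" by blast
  then show ?thesis
    using that[of "1 / real (Suc n)"] by (simp add: zero_less_iff_neq_zero)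
qed

text \<open>A jump into \<open>{..- d}\<close> carries the walk from \<open>u\<close> to at least
  \<open>u + d\<close>, so finiteness at \<open>u\<close> passes to \<open>u + d\<close>.\<close>

lemma renewal_finite_everywhere:
  assumes neg: "emeasure M {..<0} > 0" and fin: "renewal M s < \<infinity>"
  shows "renewal M t < \<infinity>"
proof -
  obtain d where d: "d > 0" "emeasure M {..- d} > 0"
    using ex_neg_mass[OF neg] by blast
  have shift: "renewal M (u + d) < \<infinity>" if "renewal M u < \<infinity>" for u
  proof -
    have "emeasure M {..- d} * renewal M (u + d) = (\<integral>\<^sup>+y. renewal M (u + d) * indicator {..- d} y \<partial>M)"
      by (subst nn_integral_cmult_indicator) (simp_all add: mult.commute)
    also have "\<dots> \<le> step M (renewal M) u"
      unfolding step_def by (intro nn_integral_mono) (auto intro: mono_renewal split: split_indicator)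
    also have "\<dots> \<le> renewal M u"
      by (subst renewal_eq[of u]) simp
    finally have "emeasure M {..- d} * renewal M (u + d) < \<infinity>"
      using that by (auto intro: le_less_trans)
    then show ?thesis
      using d(2) by (auto simp: ennreal_mult_less_top)
  qed
  have "renewal M (s + real n * d) < \<infinity>" for n
  proof (induction n)
    case (Suc n)
    then show ?case using shift[OF Suc] by (simp add: algebra_simps)
  qed (use fin in simp)
  moreover obtain n where "t - s \<le> real n * d"
    using ex_less_of_nat_mult[OF d(1), of "t - s"] by (auto intro: less_imp_le)
  then have "renewal M t \<le> renewal M (s + real n * d)"
    by (intro mono_renewal) simp
  ultimately show ?thesis
    by (auto intro: le_less_trans)
qed

text \<open>Mass on the negative axis makes the transform grow exponentially, so near-minimisers
  stay bounded; along a convergent subsequence Fatou's lemma gives lower semicontinuity. This makes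
  the critical case, known only as an infimum, accessible.\<close>

lemma ex_lap_le_1_of_inf:
  assumes neg: "emeasure M {..<0} > 0" and inf: "\<And>c. c > 1 \<Longrightarrow> \<exists>t\<ge>0. lap M t < ennreal c"
  obtains t where "t \<ge> 0" "lap M t \<le> 1"
proof -
  obtain d where d: "d > 0" "emeasure M {..- d} > 0"
    using ex_neg_mass[OF neg] by blast
  define p where "p = measure M {..- d}"
  have p: "p > 0" "emeasure M {..- d} = ennreal p"
    using d(2) by (auto simp: p_def emeasure_eq_measure)
  have "\<exists>t\<ge>0. lap M t < ennreal (1 + 1 / real (Suc n))" for n
    by (rule inf) simp
  then obtain x where x: "\<And>n. x n \<ge> 0" "\<And>n. lap M (x n) < ennreal (1 + 1 / real (Suc n))"
    by metis
  \<comment> \<open>The 2 bounds all levels \<open>1 + 1 / real (Suc n)\<close> at once.\<close>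
  have bound: "x n \<le> ln (2 / p) / d" for n
  proof -
    have "ennreal (p * exp (x n * d)) = (\<integral>\<^sup>+y. ennreal (exp (x n * d)) * indicator {..- d} y \<partial>M)"
      using p(1) by (subst nn_integral_cmult_indicator) (simp_all add: p(2) ennreal_mult mult.commute)
    also have "\<dots> \<le> lap M (x n)"
      unfolding laplace_def
    proof (intro nn_integral_mono)
      fix y
      have "x n * d \<le> - x n * y" if "y \<le> - d"
        using mult_left_mono[OF that x(1)[of n]] by simp
      then show "ennreal (exp (x n * d)) * indicator {..- d} y \<le> ennreal (exp (- x n * y))"
        by (auto split: split_indicator intro!: ennreal_leI)
    qed
    also have "\<dots> < ennreal (1 + 1 / real (Suc n))" by (rule x)
    also have "\<dots> \<le> ennreal 2" by (intro ennreal_leI) simp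
    finally have "p * exp (x n * d) < 2"
      using p by (subst (asm) ennreal_less_iff) auto
    then have "exp (x n * d) < 2 / p"
      using p by (simp add: field_simps)
    then have "x n * d < ln (2 / p)"
      using p by (metis exp_gt_zero ln_exp ln_less_cancel_iff less_trans)
    then show ?thesis
      using d by (simp add: field_simps)
  qed
  have "bounded (range x)"
    using x(1) bound by (intro boundedI[of _ "ln (2 / p) / d"]) auto
  then obtain l r where lr: "strict_mono r" "(x \<circ> r) \<longlonglongrightarrow> l"
    using bounded_imp_convergent_subsequence[of x] by auto
  have "l \<ge> 0"
    using lr(2) x(1) by (intro LIMSEQ_le_const[OF lr(2)]) auto
  have "lap M l = (\<integral>\<^sup>+y. liminf (\<lambda>n. ennreal (exp (- x (r n) * y))) \<partial>M)"
    unfolding laplace_def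
  proof (intro nn_integral_cong)
    fix y
    have "(\<lambda>n. ennreal (exp (- x (r n) * y))) \<longlonglongrightarrow> ennreal (exp (- l * y))"
      using lr(2) by (intro tendsto_intros tendsto_ennrealI) (simp add: comp_def)
    then show "ennreal (exp (- l * y)) = liminf (\<lambda>n. ennreal (exp (- x (r n) * y)))"
      using lim_imp_Liminf[OF sequentially_bot] by fastforce
  qed
  also have "\<dots> \<le> liminf (\<lambda>n. lap M (x (r n)))"
    unfolding laplace_def by (rule nn_integral_liminf) simp
  also have "\<dots> \<le> liminf (\<lambda>n. ennreal (1 + 1 / real (Suc (r n))))"
    by (intro Liminf_mono always_eventually allI less_imp_le x)
  also have "\<dots> = 1"
  proof -
    have "(\<lambda>n. 1 + 1 / real (Suc n)) \<longlonglongrightarrow> 1" by real_asymp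
    then have "(\<lambda>n. ennreal (1 + 1 / real (Suc (r n)))) \<longlonglongrightarrow> ennreal 1"
      using LIMSEQ_subseq_LIMSEQ[OF _ lr(1)] by (intro tendsto_ennrealI) (force simp: comp_def)
    then show ?thesis
      using lim_imp_Liminf[OF sequentially_bot] by fastforce
  qed
  finally show ?thesis
    using that \<open>l \<ge> 0\<close> by blast
qed

end

section \<open>Perturbed random walks\<close>

text \<open>A measure of total mass \<open>exp a\<close> when \<open>X\<close> is a random variable
  on a probability space: its n-th step power carries the factor \<open>exp (a * n)\<close>, so the
  weighted series becomes an ordinary potential.\<close>

definition weighted_law :: "'a measure \<Rightarrow> ('a \<Rightarrow> real) \<Rightarrow> real \<Rightarrow> real measure" where
  "weighted_law M X a = density (distr M borel X) (\<lambda>_. ennreal (exp a))"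

lemma (in prob_space) indep_var_nn_integral_pair:
  fixes X Y :: "'a \<Rightarrow> real"
  assumes ind: "indep_var borel X borel Y"
    and [measurable]: "(\<lambda>(x, y). f x y) \<in> borel_measurable (borel \<Otimes>\<^sub>M borel)"
  shows "(\<integral>\<^sup>+\<omega>. f (X \<omega>) (Y \<omega>) \<partial>M) = (\<integral>\<^sup>+y. (\<integral>\<^sup>+\<omega>. f (X \<omega>) y \<partial>M) \<partial>distr M borel Y)"
proof -
  have [measurable]: "random_variable borel X" "random_variable borel Y"
    and eq: "distr M borel X \<Otimes>\<^sub>M distr M borel Y = distr M (borel \<Otimes>\<^sub>M borel) (\<lambda>\<omega>. (X \<omega>, Y \<omega>))"
    using ind unfolding indep_var_distribution_eq by auto
  interpret X: prob_space "distr M borel X" by (rule prob_space_distr) fact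
  interpret Y: prob_space "distr M borel Y" by (rule prob_space_distr) fact
  interpret P: pair_sigma_finite "distr M borel X" "distr M borel Y" ..
  have "(\<integral>\<^sup>+\<omega>. f (X \<omega>) (Y \<omega>) \<partial>M) = (\<integral>\<^sup>+p. (case p of (x, y) \<Rightarrow> f x y) \<partial>(distr M borel X \<Otimes>\<^sub>M distr M borel Y))"
    unfolding eq by (subst nn_integral_distr) auto
  also have "\<dots> = (\<integral>\<^sup>+y. (\<integral>\<^sup>+x. f x y \<partial>distr M borel X) \<partial>distr M borel Y)"
    by (subst P.nn_integral_snd[symmetric]) auto
  also have "\<dots> = (\<integral>\<^sup>+y. (\<integral>\<^sup>+\<omega>. f (X \<omega>) y \<partial>M) \<partial>distr M borel Y)"
    by (intro nn_integral_cong) (subst nn_integral_distr, auto)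
  finally show ?thesis .
qed

context iid_pairs
begin

lemma measurable_pair [measurable]: "(\<lambda>\<omega>. (\<xi> n \<omega>, \<eta> n \<omega>)) \<in> borel_measurable M"
  using indep unfolding indep_vars_def by auto

lemma measurable_\<xi> [measurable]: "\<xi> n \<in> borel_measurable M"
  using measurable_compose[OF measurable_pair[of n], of fst borel] by (simp add: borel_prod[symmetric])

lemma measurable_\<eta> [measurable]: "\<eta> n \<in> borel_measurable M"
  using measurable_compose[OF measurable_pair[of n], of snd borel] by (simp add: borel_prod[symmetric])

lemma measurable_walk [measurable]: "walk \<xi> n \<in> borel_measurable M"
  unfolding walk_def[abs_def] by measurable

lemma measurable_perturbed_walk [measurable]: "perturbed_walk \<xi> \<eta> n \<in> borel_measurable M"
  unfolding perturbed_walk_def[abs_def] by measurable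

lemma distr_\<xi>: "distr M borel (\<xi> n) = distr M borel (\<xi> 0)"
proof -
  have "distr M borel (\<xi> m) = distr (distr M borel (\<lambda>\<omega>. (\<xi> m \<omega>, \<eta> m \<omega>))) borel fst" for m
    by (subst distr_distr) (auto simp: comp_def borel_prod[symmetric])
  then show ?thesis by (simp add: ident[of n])
qed

lemma distr_\<eta>: "distr M borel (\<eta> n) = distr M borel (\<eta> 0)"
proof -
  have "distr M borel (\<eta> m) = distr (distr M borel (\<lambda>\<omega>. (\<xi> m \<omega>, \<eta> m \<omega>))) borel snd" for m
    by (subst distr_distr) (auto simp: comp_def borel_prod[symmetric])
  then show ?thesis by (simp add: ident[of n])
qed

text \<open>The walk up to \<open>n\<close> involves only the pairs with indices
  \<open>1..n\<close>, so dependence inside pair \<open>Suc n\<close> does no harm. With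
  \<open>g\<close> as \<open>fst\<close> or \<open>snd\<close> this serves both the recursion of the
  walk and the perturbation.\<close>

lemma indep_walk_component:
  assumes [measurable]: "g \<in> borel_measurable (borel \<Otimes>\<^sub>M borel)"
  shows "indep_var borel (walk \<xi> n) borel (\<lambda>\<omega>. g (\<xi> (Suc n) \<omega>, \<eta> (Suc n) \<omega>) :: real)"
proof -
  have "indep_var borel ((\<lambda>f. \<Sum>k=1..n. fst (f k)) \<circ> (\<lambda>\<omega>. restrict (\<lambda>k. (\<xi> k \<omega>, \<eta> k \<omega>)) {1..n}))
    borel ((\<lambda>f. g (f (Suc n))) \<circ> (\<lambda>\<omega>. restrict (\<lambda>k. (\<xi> k \<omega>, \<eta> k \<omega>)) {Suc n}))"
  proof (intro indep_var_compose[OF indep_var_restrict[OF indep]])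
    show "(\<lambda>f. \<Sum>k = 1..n. fst (f k)) \<in> borel_measurable (Pi\<^sub>M {1..n} (\<lambda>_. borel :: (real \<times> real) measure))"
      unfolding borel_prod[symmetric] by measurable
    show "(\<lambda>f. g (f (Suc n))) \<in> borel_measurable (Pi\<^sub>M {Suc n} (\<lambda>_. borel :: (real \<times> real) measure))"
      unfolding borel_prod[symmetric] by measurable
  qed auto
  also have "(\<lambda>f. \<Sum>k=1..n. fst (f k)) \<circ> (\<lambda>\<omega>. restrict (\<lambda>k. (\<xi> k \<omega>, \<eta> k \<omega>)) {1..n}) = walk \<xi> n"
    by (auto simp: fun_eq_iff walk_def intro!: sum.cong)
  also have "(\<lambda>f. g (f (Suc n))) \<circ> (\<lambda>\<omega>. restrict (\<lambda>k. (\<xi> k \<omega>, \<eta> k \<omega>)) {Suc n})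
      = (\<lambda>\<omega>. g (\<xi> (Suc n) \<omega>, \<eta> (Suc n) \<omega>))"
    by (simp add: fun_eq_iff)
  finally show ?thesis .
qed

lemma indep_walk_\<xi>: "indep_var borel (walk \<xi> n) borel (\<xi> (Suc n))"
  using indep_walk_component[of fst n] by simp

lemma indep_walk_\<eta>: "indep_var borel (walk \<xi> n) borel (\<eta> (Suc n))"
  using indep_walk_component[of snd n] by simp

sublocale law: finite_borel_measure "distr M borel (\<xi> 0)"
  by (intro finite_borel_measure.intro finite_borel_measure_axioms.intro finite_measureI)
     (simp_all add: emeasure_distr)

lemma finite_borel_measure_weighted_law: "finite_borel_measure (weighted_law M (\<xi> 0) a)"
  unfolding weighted_law_def by (rule law.finite_borel_measure_scale) simp

lemma nn_integral_walk:
  assumes [measurable]: "h \<in> borel_measurable borel"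
  shows "(\<integral>\<^sup>+\<omega>. h (z - walk \<xi> n \<omega>) \<partial>M) = (step (distr M borel (\<xi> 0)) ^^ n) h z"
proof (induction n arbitrary: z)
  case 0
  then show ?case by (simp add: walk_def emeasure_space_1)
next
  case (Suc n)
  have "(\<integral>\<^sup>+\<omega>. h (z - walk \<xi> (Suc n) \<omega>) \<partial>M) = (\<integral>\<^sup>+\<omega>. h (z - \<xi> (Suc n) \<omega> - walk \<xi> n \<omega>) \<partial>M)"
    by (simp add: walk_def algebra_simps)
  also have "\<dots> = (\<integral>\<^sup>+y. (\<integral>\<^sup>+\<omega>. h (z - y - walk \<xi> n \<omega>) \<partial>M) \<partial>distr M borel (\<xi> (Suc n)))"
    by (rule indep_var_nn_integral_pair[OF indep_walk_\<xi>]) measurable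
  also have "\<dots> = step (distr M borel (\<xi> 0)) ((step (distr M borel (\<xi> 0)) ^^ n) h) z"
    unfolding Suc distr_\<xi>[of "Suc n"] step_def[of _ "(step (distr M borel (\<xi> 0)) ^^ n) h" z] ..
  finally show ?case by simp
qed

lemma step_pow_weighted_law:
  assumes [measurable]: "h \<in> borel_measurable borel"
  shows "(step (weighted_law M (\<xi> 0) a) ^^ n) h s = ennreal (exp (a * real n)) * (step (distr M borel (\<xi> 0)) ^^ n) h s"
proof (induction n arbitrary: s)
  case (Suc n)
  have "(step (weighted_law M (\<xi> 0) a) ^^ n) h
    = (\<lambda>s. ennreal (exp (a * real n)) * (step (distr M borel (\<xi> 0)) ^^ n) h s)"
    using Suc by auto
  then have "(step (weighted_law M (\<xi> 0) a) ^^ Suc n) h s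
    = ennreal (exp a) * (ennreal (exp (a * real n)) * (step (distr M borel (\<xi> 0)) ^^ Suc n) h s)"
    unfolding weighted_law_def by (simp add: law.step_scale law.step_cmult)
  also have "\<dots> = ennreal (exp (a * real (Suc n))) * (step (distr M borel (\<xi> 0)) ^^ Suc n) h s"
    unfolding mult.assoc[symmetric]
    by (simp add: ennreal_mult[symmetric] exp_add[symmetric] algebra_simps)
  finally show ?case .
qed simp

text \<open>The variable \<open>T_{n+1}\<close> contains only n steps, which leaves one factor
  \<open>exp a\<close> over; the perturbation \<open>\<eta> (Suc n)\<close> is replaced by
  \<open>\<eta> 0\<close> through its law.\<close>

lemma exp_renewal_eq:
  "exp_renewal M \<xi> \<eta> a y = ennreal (exp a) * (\<integral>\<^sup>+\<omega>. renewal (weighted_law M (\<xi> 0) a) (y - \<eta> 0 \<omega>) \<partial>M)"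
proof -
  let ?\<mu> = "distr M borel (\<xi> 0)" and ?I = "indicator {0..} :: real \<Rightarrow> ennreal"
  interpret W: finite_borel_measure "weighted_law M (\<xi> 0) a"
    by (rule finite_borel_measure_weighted_law)
  have P: "emeasure M {\<omega> \<in> space M. perturbed_walk \<xi> \<eta> (Suc n) \<omega> \<le> y}
      = (\<integral>\<^sup>+\<omega>. (step ?\<mu> ^^ n) ?I (y - \<eta> 0 \<omega>) \<partial>M)" for n
  proof -
    have "emeasure M {\<omega> \<in> space M. perturbed_walk \<xi> \<eta> (Suc n) \<omega> \<le> y}
        = (\<integral>\<^sup>+\<omega>. indicator {\<omega> \<in> space M. perturbed_walk \<xi> \<eta> (Suc n) \<omega> \<le> y} \<omega> \<partial>M)"
      by simp
    also have "\<dots> = (\<integral>\<^sup>+\<omega>. ?I (y - \<eta> (Suc n) \<omega> - walk \<xi> n \<omega>) \<partial>M)"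
      by (intro nn_integral_cong) (auto simp: perturbed_walk_def split: split_indicator)
    also have "\<dots> = (\<integral>\<^sup>+z. (\<integral>\<^sup>+\<omega>. ?I (y - z - walk \<xi> n \<omega>) \<partial>M) \<partial>distr M borel (\<eta> (Suc n)))"
      by (rule indep_var_nn_integral_pair[OF indep_walk_\<eta>]) measurable
    also have "\<dots> = (\<integral>\<^sup>+z. (step ?\<mu> ^^ n) ?I (y - z) \<partial>distr M borel (\<eta> 0))"
      by (simp add: nn_integral_walk distr_\<eta>[of "Suc n"])
    also have "\<dots> = (\<integral>\<^sup>+\<omega>. (step ?\<mu> ^^ n) ?I (y - \<eta> 0 \<omega>) \<partial>M)"
      by (subst nn_integral_distr) auto
    finally show ?thesis .
  qed
  have "exp_renewal M \<xi> \<eta> a y = (\<Sum>n. ennreal (exp a) * (\<integral>\<^sup>+\<omega>. (step (weighted_law M (\<xi> 0) a) ^^ n) ?I (y - \<eta> 0 \<omega>) \<partial>M))"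
    unfolding exp_renewal_def
  proof (intro suminf_cong)
    fix n
    have "ennreal (exp (a * real (Suc n))) = ennreal (exp a) * ennreal (exp (a * real n))"
      by (simp add: ennreal_mult[symmetric] exp_add[symmetric] algebra_simps)
    then show "ennreal (exp (a * real (Suc n))) * emeasure M {\<omega> \<in> space M. perturbed_walk \<xi> \<eta> (Suc n) \<omega> \<le> y}
      = ennreal (exp a) * (\<integral>\<^sup>+\<omega>. (step (weighted_law M (\<xi> 0) a) ^^ n) ?I (y - \<eta> 0 \<omega>) \<partial>M)"
      by (simp add: P step_pow_weighted_law nn_integral_cmult mult.assoc)
  qed
  also have "\<dots> = ennreal (exp a) * (\<integral>\<^sup>+\<omega>. renewal (weighted_law M (\<xi> 0) a) (y - \<eta> 0 \<omega>) \<partial>M)"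
    unfolding renewal_def potential_def by (subst nn_integral_suminf) auto
  finally show ?thesis .
qed

lemma exp_renewal_mono: "x \<le> y \<Longrightarrow> exp_renewal M \<xi> \<eta> a x \<le> exp_renewal M \<xi> \<eta> a y"
  unfolding exp_renewal_def
  by (intro suminf_le mult_left_mono emeasure_mono) auto

end

section \<open>Exponential moment of the last exit time against the weighted sum\<close>

text \<open>The term at the last exit alone equals the left-hand side; the summand 1 covers an empty
  set of visits. With infinitely many visits the sum has infinitely many terms of at least
  1.\<close>

lemma exp_last_exit_le:
  assumes "a > 0"
  shows "exp_enat a (last_exit \<xi> \<eta> x \<omega>)
    \<le> 1 + (\<Sum>n. ennreal (exp (a * real (Suc n))) * (if perturbed_walk \<xi> \<eta> (Suc n) \<omega> \<le> x then 1 else 0))"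
    (is "_ \<le> 1 + suminf ?f")
proof -
  define A where "A = {n. 1 \<le> n \<and> perturbed_walk \<xi> \<eta> n \<omega> \<le> x}"
  have exit: "last_exit \<xi> \<eta> x \<omega> = Sup (enat ` A)"
    by (simp add: last_exit_def A_def)
  have f: "?f (n - 1) = ennreal (exp (a * real n))" if "n \<in> A" for n
    using that by (auto simp: A_def)
  show ?thesis
  proof (cases "finite A")
    case True
    show ?thesis
    proof (cases "A = {}")
      case True
      then have "last_exit \<xi> \<eta> x \<omega> = enat 0"
        unfolding exit by (simp add: Sup_enat_def zero_enat_def)
      then show ?thesis by (simp add: exp_enat_def)
    next
      case False
      have "Sup (enat ` A) = Max (enat ` A)"
        using True False by (simp add: Sup_enat_def)
      also have "\<dots> = enat (Max A)"
        using True False by (intro mono_Max_commute[symmetric]) (auto simp: mono_def)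
      finally have "exp_enat a (last_exit \<xi> \<eta> x \<omega>) = ennreal (exp (a * real (Max A)))"
        by (simp add: exit exp_enat_def)
      also have "\<dots> = sum ?f {Max A - 1}"
        using f[of "Max A"] True False by simp
      also have "\<dots> \<le> suminf ?f"
        by (intro sum_le_suminf) auto
      finally show ?thesis
        by (simp add: add_increasing)
    qed
  next
    case False
    have "of_nat m \<le> suminf ?f" for m
    proof -
      obtain B where B: "B \<subseteq> A" "finite B" "card B = m"
        using infinite_arbitrarily_large[OF False] by blast
      have inj: "inj_on (\<lambda>n. n - 1) B"
      proof (rule inj_onI)
        fix m n assume "m \<in> B" "n \<in> B" and eq: "m - 1 = n - 1"
        then have "1 \<le> m" "1 \<le> n" using B(1) by (auto simp: A_def)
        then show "m = n" using eq by simp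
      qed
      have "(of_nat m :: ennreal) = (\<Sum>n\<in>B. 1)"
        using B by simp
      also have "\<dots> \<le> (\<Sum>n\<in>B. ?f (n - 1))"
      proof (intro sum_mono)
        fix n assume "n \<in> B"
        then have "n \<in> A" using B by auto
        show "1 \<le> ?f (n - 1)"
          unfolding f[OF \<open>n \<in> A\<close>] using assms by simp
      qed
      also have "\<dots> = sum ?f ((\<lambda>n. n - 1) ` B)"
        by (subst sum.reindex[OF inj]) simp
      also have "\<dots> \<le> suminf ?f"
        using B by (intro sum_le_suminf) auto
      finally show ?thesis .
    qed
    then have "(SUP m. of_nat m :: ennreal) \<le> suminf ?f"
      by (rule SUP_least)
    then have "suminf ?f = \<infinity>"
      by (simp only: ennreal_SUP_of_nat_eq_top top_unique infinity_ennreal_def)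
    then show ?thesis by simp
  qed
qed

text \<open>Replacing every indicator up to the last exit \<open>m\<close> by 1 leaves a geometric
  sum, which the factor \<open>1 - exp (- a)\<close> turns into
  \<open>exp (a * m) - 1\<close>.\<close>

lemma sum_le_exp_last_exit:
  assumes "a > 0"
  shows "ennreal (1 - exp (- a)) * (\<Sum>n. ennreal (exp (a * real (Suc n))) * (if perturbed_walk \<xi> \<eta> (Suc n) \<omega> \<le> x then 1 else 0))
    \<le> exp_enat a (last_exit \<xi> \<eta> x \<omega>)"
    (is "_ * suminf ?f \<le> _")
proof (cases "last_exit \<xi> \<eta> x \<omega>")
  case (enat m)
  have zero: "?f n = 0" if "n \<ge> m" for n
  proof -
    have "\<not> perturbed_walk \<xi> \<eta> (Suc n) \<omega> \<le> x"
    proof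
      assume "perturbed_walk \<xi> \<eta> (Suc n) \<omega> \<le> x"
      then have "enat (Suc n) \<le> last_exit \<xi> \<eta> x \<omega>"
        unfolding last_exit_def by (intro Sup_upper) auto
      then show False using enat that by simp
    qed
    then show ?thesis by simp
  qed
  have "(1 - exp (- a)) * (\<Sum>n<m. exp (a * real (Suc n))) = exp (a * real m) - 1" for m
  proof (induction m)
    case (Suc m)
    have "exp (- a) * exp (a * real (Suc m)) = exp (a * real m)"
      by (simp add: exp_add[symmetric] algebra_simps)
    with Suc show ?case
      by (simp only: sum.lessThan_Suc distrib_left left_diff_distrib mult_1)
  qed simp
  note geo = this
  have "suminf ?f = (\<Sum>n<m. ?f n)"
    by (rule suminf_finite) (use zero in auto)
  also have "\<dots> \<le> (\<Sum>n<m. ennreal (exp (a * real (Suc n))))"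
    by (intro sum_mono) auto
  also have "\<dots> = ennreal (\<Sum>n<m. exp (a * real (Suc n)))"
    by (rule sum_ennreal) simp
  finally have "ennreal (1 - exp (- a)) * suminf ?f \<le> ennreal (1 - exp (- a)) * ennreal (\<Sum>n<m. exp (a * real (Suc n)))"
    by (rule mult_left_mono) simp
  also have "\<dots> = ennreal (exp (a * real m) - 1)"
    using assms by (subst ennreal_mult[symmetric]) (simp_all only: geo, auto intro: sum_nonneg)
  also have "\<dots> \<le> exp_enat a (last_exit \<xi> \<eta> x \<omega>)"
    by (simp add: enat exp_enat_def ennreal_leI)
  finally show ?thesis .
qed (simp add: exp_enat_def)

context iid_pairs
begin

lemma exp_renewal_eq_nn_integral:
  "exp_renewal M \<xi> \<eta> a x = (\<integral>\<^sup>+\<omega>. (\<Sum>n. ennreal (exp (a * real (Suc n))) *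
    (if perturbed_walk \<xi> \<eta> (Suc n) \<omega> \<le> x then 1 else 0)) \<partial>M)"
proof -
  have "emeasure M {\<omega> \<in> space M. perturbed_walk \<xi> \<eta> (Suc n) \<omega> \<le> x}
    = (\<integral>\<^sup>+\<omega>. (if perturbed_walk \<xi> \<eta> (Suc n) \<omega> \<le> x then 1 else 0) \<partial>M)" for n
  proof -
    have "emeasure M {\<omega> \<in> space M. perturbed_walk \<xi> \<eta> (Suc n) \<omega> \<le> x}
        = (\<integral>\<^sup>+\<omega>. indicator {\<omega> \<in> space M. perturbed_walk \<xi> \<eta> (Suc n) \<omega> \<le> x} \<omega> \<partial>M)"
      by simp
    also have "\<dots> = (\<integral>\<^sup>+\<omega>. (if perturbed_walk \<xi> \<eta> (Suc n) \<omega> \<le> x then 1 else 0) \<partial>M)"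
      by (intro nn_integral_cong) (auto split: split_indicator)
    finally show ?thesis .
  qed
  then show ?thesis
    unfolding exp_renewal_def
    by (subst nn_integral_suminf) (auto simp: nn_integral_cmult)
qed

lemma last_exit_exp_moment_finite_iff:
  assumes "a > 0"
  shows "last_exit_exp_moment M \<xi> \<eta> a x < \<infinity> \<longleftrightarrow> exp_renewal M \<xi> \<eta> a x < \<infinity>"
proof
  let ?g = "\<lambda>\<omega>. \<Sum>n. ennreal (exp (a * real (Suc n))) * (if perturbed_walk \<xi> \<eta> (Suc n) \<omega> \<le> x then 1 else 0)"
  assume fin: "last_exit_exp_moment M \<xi> \<eta> a x < \<infinity>"
  have "ennreal (1 - exp (- a)) * exp_renewal M \<xi> \<eta> a x = (\<integral>\<^sup>+\<omega>. ennreal (1 - exp (- a)) * ?g \<omega> \<partial>M)"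
    unfolding exp_renewal_eq_nn_integral by (rule nn_integral_cmult[symmetric]) measurable
  also have "\<dots> \<le> last_exit_exp_moment M \<xi> \<eta> a x"
    unfolding last_exit_exp_moment_def by (intro nn_integral_mono sum_le_exp_last_exit assms)
  finally have "ennreal (1 - exp (- a)) * exp_renewal M \<xi> \<eta> a x < \<infinity>"
    using fin by (rule le_less_trans)
  then show "exp_renewal M \<xi> \<eta> a x < \<infinity>"
    using assms by (auto simp: ennreal_mult_less_top)
next
  let ?g = "\<lambda>\<omega>. \<Sum>n. ennreal (exp (a * real (Suc n))) * (if perturbed_walk \<xi> \<eta> (Suc n) \<omega> \<le> x then 1 else 0)"
  assume fin: "exp_renewal M \<xi> \<eta> a x < \<infinity>"
  have "last_exit_exp_moment M \<xi> \<eta> a x \<le> (\<integral>\<^sup>+\<omega>. 1 + ?g \<omega> \<partial>M)"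
    unfolding last_exit_exp_moment_def by (intro nn_integral_mono exp_last_exit_le assms)
  also have "\<dots> = 1 + exp_renewal M \<xi> \<eta> a x"
    unfolding exp_renewal_eq_nn_integral by (subst nn_integral_add) (auto simp: emeasure_space_1)
  also have "\<dots> < \<infinity>" using fin by simp
  finally show "last_exit_exp_moment M \<xi> \<eta> a x < \<infinity>" .
qed

end

section \<open>Criteria for finiteness of the weighted renewal series\<close>

context iid_pairs
begin

abbreviation "\<nu> a \<equiv> weighted_law M (\<xi> 0) a"

lemma lap_weighted_law: "lap (\<nu> a) t = ennreal (exp a) * laplace M (\<xi> 0) t"
  unfolding weighted_law_def laplace_def
  by (subst nn_integral_density, simp, simp, subst nn_integral_cmult, simp, subst nn_integral_distr) auto

lemma ennreal_exp_mult_iff: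
  "ennreal (exp a) * p < 1 \<longleftrightarrow> p < ennreal (exp (- a))"
  "ennreal (exp a) * p \<le> 1 \<longleftrightarrow> p \<le> ennreal (exp (- a))"
  "ennreal (exp a) * p = 1 \<longleftrightarrow> p = ennreal (exp (- a))"
proof -
  have 1: "ennreal (exp a) * ennreal (exp (- a)) = 1"
    by (simp add: ennreal_mult[symmetric] exp_minus)
  have iff: "ennreal (exp a) * q \<le> ennreal (exp a) * r \<longleftrightarrow> q \<le> r" for q r
    by (rule ennreal_mult_le_mult_iff) auto
  show le: "ennreal (exp a) * p \<le> 1 \<longleftrightarrow> p \<le> ennreal (exp (- a))"
    using iff[of p "ennreal (exp (- a))"] by (simp only: 1)
  have ge: "1 \<le> ennreal (exp a) * p \<longleftrightarrow> ennreal (exp (- a)) \<le> p"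
    using iff[of "ennreal (exp (- a))" p] by (simp only: 1)
  show "ennreal (exp a) * p < 1 \<longleftrightarrow> p < ennreal (exp (- a))"
    using ge by (auto simp: not_le[symmetric])
  show "ennreal (exp a) * p = 1 \<longleftrightarrow> p = ennreal (exp (- a))"
    using le ge by (auto simp: eq_iff)
qed

lemma emeasure_weighted_law:
  "A \<in> sets borel \<Longrightarrow> emeasure (\<nu> a) A = ennreal (exp a) * emeasure M {\<omega> \<in> space M. \<xi> 0 \<omega> \<in> A}"
  unfolding weighted_law_def
  by (subst emeasure_density_const)
     (auto simp: emeasure_distr vimage_def Int_def conj_commute)

lemma AE_weighted_law:
  assumes "Measurable.pred borel P"
  shows "(AE y in \<nu> a. P y) \<longleftrightarrow> (AE \<omega> in M. P (\<xi> 0 \<omega>))"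
  unfolding weighted_law_def using assms by (subst AE_density) (auto simp: AE_distr_iff)

lemma tilted_mean_weighted_law:
  "tilted_mean (\<nu> a) (\<lambda>y. y) t = exp a * tilted_mean M (\<xi> 0) t"
  unfolding weighted_law_def tilted_mean_def
  by (subst integral_real_density, simp, simp, simp, subst integral_distr) auto

lemma mem_exponent_roots_iff: "g \<in> exponent_roots M (\<xi> 0) a \<longleftrightarrow> 0 < g \<and> lap (\<nu> a) g = 1"
  by (simp add: exponent_roots_def lap_weighted_law ennreal_exp_mult_iff)

lemma weighted_law_mass: "a > 0 \<Longrightarrow> emeasure (\<nu> a) UNIV > 1"
  by (simp add: emeasure_weighted_law emeasure_space_1)

lemma is_minimal_rootI:
  assumes "0 < g" "lap (\<nu> a) g = 1" "\<And>s. 0 \<le> s \<Longrightarrow> s < g \<Longrightarrow> lap (\<nu> a) s > 1"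
  shows "is_minimal_root M (\<xi> 0) a g"
  unfolding is_minimal_root_def
proof (intro conjI ballI)
  fix g' assume "g' \<in> exponent_roots M (\<xi> 0) a"
  then have "0 < g'" "lap (\<nu> a) g' = 1" by (simp_all add: mem_exponent_roots_iff)
  then show "g \<le> g'"
    using assms(3)[of g'] by (cases "g' < g") auto
qed (use assms in \<open>simp add: mem_exponent_roots_iff\<close>)

text \<open>Any root serves here, minimal or not: it makes \<open>exp (g * s)\<close> excessive, and
  the exponential bound at \<open>y - \<eta> 0\<close> factors into a constant and the Laplace
  integrand of \<open>\<eta> 0\<close>.\<close>

lemma exp_renewal_finite:
  assumes fin: "renewal (\<nu> a) 1 < \<infinity>" and g: "0 < g" "lap (\<nu> a) g = 1" and \<eta>: "laplace M (\<eta> 0) g < \<infinity>"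
  shows "exp_renewal M \<xi> \<eta> a y < \<infinity>"
proof -
  interpret W: finite_borel_measure "\<nu> a"
    by (rule finite_borel_measure_weighted_law)
  define D where "D = renewal (\<nu> a) 1 * ennreal (exp g / (1 - exp (- g)))"
  have D: "D < \<infinity>"
    unfolding D_def using fin by (simp add: ennreal_mult_less_top)
  have "(\<integral>\<^sup>+\<omega>. renewal (\<nu> a) (y - \<eta> 0 \<omega>) \<partial>M)
      \<le> (\<integral>\<^sup>+\<omega>. (D * ennreal (exp (g * y))) * ennreal (exp (- g * \<eta> 0 \<omega>)) \<partial>M)"
  proof (rule nn_integral_mono)
    fix \<omega>
    have "renewal (\<nu> a) (y - \<eta> 0 \<omega>) \<le> D * ennreal (exp (g * (y - \<eta> 0 \<omega>)))"
      unfolding D_def by (rule W.renewal_exp_bound) (use g in auto)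
    also have "ennreal (exp (g * (y - \<eta> 0 \<omega>))) = ennreal (exp (g * y)) * ennreal (exp (- g * \<eta> 0 \<omega>))"
      by (simp add: ennreal_mult[symmetric] exp_add[symmetric] algebra_simps)
    finally show "renewal (\<nu> a) (y - \<eta> 0 \<omega>) \<le> (D * ennreal (exp (g * y))) * ennreal (exp (- g * \<eta> 0 \<omega>))"
      by (simp only: mult.assoc)
  qed
  also have "\<dots> = D * ennreal (exp (g * y)) * laplace M (\<eta> 0) g"
    unfolding laplace_def by (rule nn_integral_cmult) measurable
  also have "\<dots> < \<infinity>"
    using D \<eta> by (simp add: ennreal_mult_less_top)
  finally show ?thesis
    unfolding exp_renewal_eq by (simp add: ennreal_mult_less_top)
qed

text \<open>The growth rate \<open>t\<close> of the renewal function only has to dominate the root: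
  for \<open>y - \<eta> 0 \<ge> 0\<close> the lower bound with \<open>t\<close> covers
  \<open>g \<le> t\<close>, and otherwise \<open>exp (- g * \<eta> 0)\<close> is at most
  \<open>exp (- g * y)\<close>.\<close>

lemma root_of_exp_renewal_finite:
  assumes "a > 0" and fin: "\<And>s. renewal (\<nu> a) s < \<infinity>" and V: "exp_renewal M \<xi> \<eta> a y < \<infinity>"
  obtains g where "0 < g" "lap (\<nu> a) g = 1" "\<And>s. 0 \<le> s \<Longrightarrow> s < g \<Longrightarrow> lap (\<nu> a) s > 1"
    "laplace M (\<eta> 0) g < \<infinity>"
proof -
  interpret W: finite_borel_measure "\<nu> a"
    by (rule finite_borel_measure_weighted_law)
  obtain t c where t: "t \<ge> 0" "lap (\<nu> a) t \<le> 1" and c: "c > 0"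
    and lower: "\<And>s. s \<ge> 0 \<Longrightarrow> ennreal (c * exp (t * s)) \<le> renewal (\<nu> a) s"
    using W.renewal_exponent[OF fin] by blast
  obtain g where g: "0 < g" "g \<le> t" "lap (\<nu> a) g = 1" "\<And>s. 0 \<le> s \<Longrightarrow> s < g \<Longrightarrow> lap (\<nu> a) s > 1"
    using W.ex_minimal_root[OF t weighted_law_mass[OF assms(1)]] by blast
  have int_fin: "(\<integral>\<^sup>+\<omega>. renewal (\<nu> a) (y - \<eta> 0 \<omega>) \<partial>M) < \<infinity>"
    using V unfolding exp_renewal_eq by (auto simp: ennreal_mult_less_top)
  have "laplace M (\<eta> 0) g
      \<le> (\<integral>\<^sup>+\<omega>. ennreal (exp (- g * y)) + ennreal (exp (- g * y) / c) * renewal (\<nu> a) (y - \<eta> 0 \<omega>) \<partial>M)"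
    unfolding laplace_def
  proof (rule nn_integral_mono)
    fix \<omega>
    let ?e = "ennreal (exp (- g * y) / c)" and ?s = "y - \<eta> 0 \<omega>"
    show "ennreal (exp (- g * \<eta> 0 \<omega>)) \<le> ennreal (exp (- g * y)) + ?e * renewal (\<nu> a) ?s"
    proof (cases "?s \<ge> 0")
      case True
      have "exp (- g * \<eta> 0 \<omega>) = exp (- g * y) * exp (g * ?s)"
        by (simp add: exp_add[symmetric] algebra_simps)
      also have "\<dots> \<le> exp (- g * y) * exp (t * ?s)"
        using g(2) True by (intro mult_left_mono) (auto intro: mult_right_mono)
      also have "\<dots> = exp (- g * y) / c * (c * exp (t * ?s))"
        using c by simp
      finally have "ennreal (exp (- g * \<eta> 0 \<omega>)) \<le> ennreal (exp (- g * y) / c * (c * exp (t * ?s)))"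
        by (rule ennreal_leI)
      also have "\<dots> = ?e * ennreal (c * exp (t * ?s))"
        using c by (intro ennreal_mult) auto
      also have "\<dots> \<le> ?e * renewal (\<nu> a) ?s"
        by (intro mult_left_mono lower True) auto
      finally show ?thesis by (simp add: add_increasing)
    next
      case False
      then have "ennreal (exp (- g * \<eta> 0 \<omega>)) \<le> ennreal (exp (- g * y))"
        using g(1) by (intro ennreal_leI) auto
      then show ?thesis by (simp add: add_increasing2)
    qed
  qed
  also have "\<dots> = ennreal (exp (- g * y)) + ennreal (exp (- g * y) / c) * (\<integral>\<^sup>+\<omega>. renewal (\<nu> a) (y - \<eta> 0 \<omega>) \<partial>M)"
    by (subst nn_integral_add) (auto simp: nn_integral_cmult emeasure_space_1)
  also have "\<dots> < \<infinity>"
    using int_fin by (simp add: ennreal_mult_less_top)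
  finally show ?thesis
    using that g by blast
qed

lemma AE_renewal_finite:
  assumes "exp_renewal M \<xi> \<eta> a y < \<infinity>"
  shows "AE \<omega> in M. renewal (\<nu> a) (y - \<eta> 0 \<omega>) < \<infinity>"
proof -
  interpret W: finite_borel_measure "\<nu> a"
    by (rule finite_borel_measure_weighted_law)
  have "(\<integral>\<^sup>+\<omega>. renewal (\<nu> a) (y - \<eta> 0 \<omega>) \<partial>M) \<noteq> \<infinity>"
    using assms unfolding exp_renewal_eq by (auto simp: ennreal_mult_less_top)
  then have "AE \<omega> in M. renewal (\<nu> a) (y - \<eta> 0 \<omega>) \<noteq> \<infinity>"
    by (rule nn_integral_noteq_infinite[rotated]) measurable
  then show ?thesis by (simp add: less_top)
qed

text \<open>Since \<xi> is nonnegative and not almost surely 0, the transform decreases strictly.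
  The second conclusion identifies a root found elsewhere as the unique one.\<close>

lemma nonneg_unique_root:
  assumes "a > 0" and nonneg: "AE \<omega> in M. \<xi> 0 \<omega> \<ge> 0" and t: "t \<ge> 0" "lap (\<nu> a) t \<le> 1"
  obtains g where "is_unique_root M (\<xi> 0) a g"
    "\<And>g'. 0 < g' \<Longrightarrow> lap (\<nu> a) g' = 1 \<Longrightarrow> is_unique_root M (\<xi> 0) a g'"
proof -
  interpret W: finite_borel_measure "\<nu> a"
    by (rule finite_borel_measure_weighted_law)
  have "\<not> (AE \<omega> in M. \<xi> 0 \<omega> = 0)"
    using \<xi>_nondeg by (auto simp: prob_Collect_eq_1[symmetric])
  then have strict: "lap (\<nu> a) u < lap (\<nu> a) s" if "0 \<le> s" "s < u" for s u
    using that nonneg by (intro W.lap_strict_antimono) (simp_all add: AE_weighted_law)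
  have uniq: "is_unique_root M (\<xi> 0) a g" if "0 < g" "lap (\<nu> a) g = 1" for g
    unfolding is_unique_root_def
  proof (intro conjI ballI)
    fix g' assume "g' \<in> exponent_roots M (\<xi> 0) a"
    then have "0 < g'" "lap (\<nu> a) g' = 1" by (simp_all add: mem_exponent_roots_iff)
    then show "g' = g"
      using strict[of g g'] strict[of g' g] that by (cases g g' rule: linorder_cases) auto
  qed (use that in \<open>simp add: mem_exponent_roots_iff\<close>)
  obtain g where "0 < g" "lap (\<nu> a) g = 1"
    using W.ex_minimal_root[OF t weighted_law_mass[OF \<open>a > 0\<close>]] by blast
  then show ?thesis using that uniq by blast
qed

lemma atom_less_iff:
  "ereal a < neg_ln (emeasure M {\<omega> \<in> space M. \<xi> 0 \<omega> = 0}) \<longleftrightarrow> emeasure (\<nu> a) {0} < 1"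
  by (simp add: less_neg_ln_iff emeasure_weighted_law ennreal_exp_mult_iff)

text \<open>No critical case arises for nonnegative steps: once the atom of the weighted law at 0 is
  below 1, the transform falls strictly below 1 and Chernoff's bound applies.\<close>

lemma nonneg_renewal_finite:
  assumes nonneg: "AE \<omega> in M. \<xi> 0 \<omega> \<ge> 0" and "emeasure (\<nu> a) {0} < 1"
  obtains t where "t \<ge> 0" "lap (\<nu> a) t \<le> 1" "\<And>s. renewal (\<nu> a) s < \<infinity>"
proof -
  interpret W: finite_borel_measure "\<nu> a"
    by (rule finite_borel_measure_weighted_law)
  obtain t where "t \<ge> 0" "lap (\<nu> a) t < 1"
    using W.ex_lap_less_1_of_atom[OF _ assms(2)] nonneg by (auto simp: AE_weighted_law)
  then show ?thesis
    using that[of t] W.renewal_finite_if_lap_less_1 by auto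
qed

lemma nonneg_exp_renewal_finite:
  assumes "a > 0" and nonneg: "AE \<omega> in M. \<xi> 0 \<omega> \<ge> 0"
    and "ereal a < neg_ln (emeasure M {\<omega> \<in> space M. \<xi> 0 \<omega> = 0})"
    and "is_unique_root M (\<xi> 0) a g" "laplace M (\<eta> 0) g < \<infinity>"
  shows "exp_renewal M \<xi> \<eta> a y < \<infinity>"
proof (rule exp_renewal_finite)
  show "renewal (\<nu> a) 1 < \<infinity>"
    using nonneg_renewal_finite[OF nonneg] assms(3) unfolding atom_less_iff by blast
qed (use assms in \<open>auto simp: is_unique_root_def mem_exponent_roots_iff\<close>)

text \<open>For nonnegative steps the renewal function vanishes on the negative axis, so finiteness
  there says nothing. The hypothesis on \<open>\<eta>\<close> provides an argument
  \<open>y - \<eta> 0 \<ge> 0\<close> with a finite value, hence finiteness at 0.\<close>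

lemma nonneg_condition_of_exp_renewal_finite:
  assumes "a > 0" and nonneg: "AE \<omega> in M. \<xi> 0 \<omega> \<ge> 0"
    and \<eta>: "\<P>(\<omega> in M. \<eta> 0 \<omega> \<le> y) > 0" and V: "exp_renewal M \<xi> \<eta> a y < \<infinity>"
  shows "ereal a < neg_ln (emeasure M {\<omega> \<in> space M. \<xi> 0 \<omega> = 0})"
    and "\<exists>g. is_unique_root M (\<xi> 0) a g \<and> laplace M (\<eta> 0) g < \<infinity>"
proof -
  interpret W: finite_borel_measure "\<nu> a"
    by (rule finite_borel_measure_weighted_law)
  have "\<exists>\<omega>\<in>space M. \<eta> 0 \<omega> \<le> y \<and> renewal (\<nu> a) (y - \<eta> 0 \<omega>) < \<infinity>"
  proof (rule ccontr)
    assume *: "\<not> ?thesis"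
    have "AE \<omega> in M. \<not> \<eta> 0 \<omega> \<le> y"
      using AE_renewal_finite[OF V] AE_space by eventually_elim (use * in auto)
    then have "\<P>(\<omega> in M. \<eta> 0 \<omega> \<le> y) = 0"
      by (intro measure_eq_0_null_sets) (simp add: AE_iff_null)
    then show False using \<eta> by simp
  qed
  then obtain \<omega> where "\<eta> 0 \<omega> \<le> y" "renewal (\<nu> a) (y - \<eta> 0 \<omega>) < \<infinity>" by blast
  then have "renewal (\<nu> a) 0 < \<infinity>"
    using W.mono_renewal[of 0 "y - \<eta> 0 \<omega>"] by (auto intro: le_less_trans)
  then have atom: "emeasure (\<nu> a) {0} < 1"
    by (rule W.emeasure_atom_less_1_of_renewal_finite)
  then show "ereal a < neg_ln (emeasure M {\<omega> \<in> space M. \<xi> 0 \<omega> = 0})"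
    by (simp add: atom_less_iff)
  obtain t where t: "t \<ge> 0" "lap (\<nu> a) t \<le> 1" and fin: "\<And>s. renewal (\<nu> a) s < \<infinity>"
    using nonneg_renewal_finite[OF nonneg atom] by blast
  obtain g where "0 < g" "lap (\<nu> a) g = 1" "laplace M (\<eta> 0) g < \<infinity>"
    using root_of_exp_renewal_finite[OF \<open>a > 0\<close> fin V] by blast
  then show "\<exists>g. is_unique_root M (\<xi> 0) a g \<and> laplace M (\<eta> 0) g < \<infinity>"
    using nonneg_unique_root[OF \<open>a > 0\<close> nonneg t] by metis
qed

lemma le_R_exponent_of_lap:
  assumes "t \<ge> 0" "lap (\<nu> a) t \<le> 1"
  shows "ereal a \<le> R_exponent M (\<xi> 0)"
  unfolding R_exponent_def le_neg_ln_iff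
  using assms by (intro INF_lower2[of t]) (auto simp: lap_weighted_law ennreal_exp_mult_iff)

lemma less_R_exponent_iff: "ereal a < R_exponent M (\<xi> 0) \<longleftrightarrow> (\<exists>t\<ge>0. lap (\<nu> a) t < 1)"
  unfolding R_exponent_def less_neg_ln_iff
  by (auto simp: INF_less_iff lap_weighted_law ennreal_exp_mult_iff)

lemma ex_minimal_root_of_le_R:
  assumes "a > 0" and neg: "emeasure (\<nu> a) {..<0} > 0" and le: "ereal a \<le> R_exponent M (\<xi> 0)"
  shows "\<exists>g. is_minimal_root M (\<xi> 0) a g"
proof -
  interpret W: finite_borel_measure "\<nu> a"
    by (rule finite_borel_measure_weighted_law)
  \<comment> \<open>At \<open>a = R\<close> the infimum is only known to be at most
    \<open>exp (- a)\<close>; the slack \<open>ln c\<close> in the exponent makes it strict, so that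
    some \<open>t\<close> does the job.\<close>
  have "\<exists>t\<ge>0. lap (\<nu> a) t < ennreal c" if "c > 1" for c
  proof -
    have "(INF t\<in>{0..}. laplace M (\<xi> 0) t) \<le> ennreal (exp (- a))"
      using le by (simp add: R_exponent_def le_neg_ln_iff)
    also have "\<dots> < ennreal (exp (- (a - ln c)))"
      using that by (intro ennreal_lessI) auto
    finally obtain t where t: "t \<ge> 0" "laplace M (\<xi> 0) t < ennreal (exp (- (a - ln c)))"
      by (auto simp: INF_less_iff)
    have "lap (\<nu> a) t = ennreal (exp a) * laplace M (\<xi> 0) t"
      by (rule lap_weighted_law)
    also have "\<dots> < ennreal (exp a) * ennreal (exp (- (a - ln c)))"
      using t(2) by (intro ennreal_mult_strict_left_mono) auto
    also have "\<dots> = ennreal c"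
      using that by (simp add: ennreal_mult[symmetric] exp_add[symmetric])
    finally show ?thesis using t(1) by blast
  qed
  then obtain t where t: "t \<ge> 0" "lap (\<nu> a) t \<le> 1"
    using W.ex_lap_le_1_of_inf[OF neg] by blast
  then show ?thesis
    using W.ex_minimal_root[OF t weighted_law_mass[OF \<open>a > 0\<close>]] is_minimal_rootI by metis
qed

definition signed_condition :: "real \<Rightarrow> bool" where
  "signed_condition a \<longleftrightarrow> (\<exists>\<gamma>. is_minimal_root M (\<xi> 0) a \<gamma> \<and>
     (ereal a < R_exponent M (\<xi> 0) \<and> laplace M (\<eta> 0) \<gamma> < \<infinity> \<or>
      ereal a = R_exponent M (\<xi> 0) \<and> tilted_mean M (\<xi> 0) \<gamma> > 0 \<and> laplace M (\<eta> 0) \<gamma> < \<infinity>))"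

lemma exp_renewal_finite_of_signed_condition:
  assumes "signed_condition a"
  shows "exp_renewal M \<xi> \<eta> a y < \<infinity>"
proof -
  interpret W: finite_borel_measure "\<nu> a"
    by (rule finite_borel_measure_weighted_law)
  obtain g where min: "is_minimal_root M (\<xi> 0) a g" and \<eta>: "laplace M (\<eta> 0) g < \<infinity>"
    and or: "ereal a < R_exponent M (\<xi> 0) \<or> tilted_mean M (\<xi> 0) g > 0"
    using assms unfolding signed_condition_def by blast
  have g: "0 < g" "lap (\<nu> a) g = 1"
    using min by (auto simp: is_minimal_root_def mem_exponent_roots_iff)
  have "renewal (\<nu> a) 1 < \<infinity>"
    using or
  proof
    assume "ereal a < R_exponent M (\<xi> 0)"
    then show ?thesis
      unfolding less_R_exponent_iff using W.renewal_finite_if_lap_less_1 by blast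
  next
    assume "tilted_mean M (\<xi> 0) g > 0"
    then show ?thesis
      by (intro W.renewal_finite_of_tilted_mean_pos[OF g]) (simp add: tilted_mean_weighted_law)
  qed
  then show ?thesis
    by (rule exp_renewal_finite) fact+
qed

text \<open>Negative jumps spread finiteness from any single argument to the whole line. The tilted
  mean then comes out positive whether \<open>a\<close> is below R or equal to it, so no case
  analysis precedes the choice of the root.\<close>

lemma signed_condition_of_exp_renewal_finite:
  assumes "a > 0" and neg: "emeasure (\<nu> a) {..<0} > 0" and V: "exp_renewal M \<xi> \<eta> a y < \<infinity>"
  shows "signed_condition a"
proof -
  interpret W: finite_borel_measure "\<nu> a"
    by (rule finite_borel_measure_weighted_law)
  have "\<exists>\<omega>. renewal (\<nu> a) (y - \<eta> 0 \<omega>) < \<infinity>"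
  proof (rule ccontr)
    assume "\<not> ?thesis"
    then have "AE \<omega> in M. False"
      using AE_renewal_finite[OF V] by simp
    then show False by simp
  qed
  then have fin: "renewal (\<nu> a) s < \<infinity>" for s
    using W.renewal_finite_everywhere[OF neg] by blast
  obtain g where g: "0 < g" "lap (\<nu> a) g = 1" "\<And>s. 0 \<le> s \<Longrightarrow> s < g \<Longrightarrow> lap (\<nu> a) s > 1"
    and \<eta>: "laplace M (\<eta> 0) g < \<infinity>"
    using root_of_exp_renewal_finite[OF \<open>a > 0\<close> fin V] by blast
  have "tilted_mean M (\<xi> 0) g > 0"
    using W.tilted_mean_pos_of_renewal_finite[OF fin g]
    by (simp add: tilted_mean_weighted_law zero_less_mult_iff)
  moreover have "ereal a \<le> R_exponent M (\<xi> 0)"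
    using g by (intro le_R_exponent_of_lap[of g]) auto
  ultimately show ?thesis
    unfolding signed_condition_def using is_minimal_rootI[OF g] \<eta> by (auto simp: le_less)
qed

end

theorem theorem2p7:
  fixes M :: "'a measure" and \<xi> \<eta> :: "nat \<Rightarrow> 'a \<Rightarrow> real" and a :: real
  assumes "iid_pairs M \<xi> \<eta>"
    and "positively_divergent M \<xi> \<eta>"
    and "a > 0"
  shows
    "(\<P>(\<omega> in M. \<xi> 0 \<omega> \<ge> 0) = 1 \<longrightarrow>
       (ereal a < neg_ln (emeasure M {\<omega> \<in> space M. \<xi> 0 \<omega> = 0}) \<longrightarrow>
          (\<exists>\<gamma>. is_unique_root M (\<xi> 0) a \<gamma>)) \<and>
       (\<forall>x::real. \<P>(\<omega> in M. \<eta> 0 \<omega> \<le> x) > 0 \<longrightarrow>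
          (last_exit_exp_moment M \<xi> \<eta> a x < \<infinity> \<longleftrightarrow> (\<exists>y\<ge>x. exp_renewal M \<xi> \<eta> a y < \<infinity>)) \<and>
          (last_exit_exp_moment M \<xi> \<eta> a x < \<infinity> \<longleftrightarrow> (\<forall>y\<ge>x. exp_renewal M \<xi> \<eta> a y < \<infinity>)) \<and>
          (last_exit_exp_moment M \<xi> \<eta> a x < \<infinity> \<longleftrightarrow>
             ereal a < neg_ln (emeasure M {\<omega> \<in> space M. \<xi> 0 \<omega> = 0}) \<and>
             (\<exists>\<gamma>. is_unique_root M (\<xi> 0) a \<gamma> \<and> laplace M (\<eta> 0) \<gamma> < \<infinity>))))
     \<and>
     (\<P>(\<omega> in M. \<xi> 0 \<omega> < 0) > 0 \<longrightarrow>
       (ereal a \<le> R_exponent M (\<xi> 0) \<longrightarrow> (\<exists>\<gamma>. is_minimal_root M (\<xi> 0) a \<gamma>)) \<and>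
       ((\<exists>x. last_exit_exp_moment M \<xi> \<eta> a x < \<infinity>) \<longleftrightarrow> (\<forall>x. last_exit_exp_moment M \<xi> \<eta> a x < \<infinity>)) \<and>
       ((\<forall>x. last_exit_exp_moment M \<xi> \<eta> a x < \<infinity>) \<longleftrightarrow> (\<exists>x. exp_renewal M \<xi> \<eta> a x < \<infinity>)) \<and>
       ((\<exists>x. exp_renewal M \<xi> \<eta> a x < \<infinity>) \<longleftrightarrow> (\<forall>x. exp_renewal M \<xi> \<eta> a x < \<infinity>)) \<and>
       ((\<forall>x. exp_renewal M \<xi> \<eta> a x < \<infinity>) \<longleftrightarrow>
          (\<exists>\<gamma>. is_minimal_root M (\<xi> 0) a \<gamma> \<and>
             (ereal a < R_exponent M (\<xi> 0) \<and> laplace M (\<eta> 0) \<gamma> < \<infinity> \<or>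
              ereal a = R_exponent M (\<xi> 0) \<and> tilted_mean M (\<xi> 0) \<gamma> > 0 \<and> laplace M (\<eta> 0) \<gamma> < \<infinity>))))"
    (is "(_ \<longrightarrow> ?uniq \<and> (\<forall>x. _ \<longrightarrow> ?A x)) \<and> (_ \<longrightarrow> ?minim \<and> ?B)")
proof -
  interpret iid_pairs M \<xi> \<eta> by fact
  note moment_iff = last_exit_exp_moment_finite_iff[OF \<open>a > 0\<close>]
  have "?uniq \<and> (\<forall>x. \<P>(\<omega> in M. \<eta> 0 \<omega> \<le> x) > 0 \<longrightarrow> ?A x)" if "\<P>(\<omega> in M. \<xi> 0 \<omega> \<ge> 0) = 1"
  proof (intro conjI[of ?uniq] allI impI)
    have nonneg: "AE \<omega> in M. \<xi> 0 \<omega> \<ge> 0"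
      using that by (simp add: prob_Collect_eq_1)
    show "\<exists>\<gamma>. is_unique_root M (\<xi> 0) a \<gamma>"
      if "ereal a < neg_ln (emeasure M {\<omega> \<in> space M. \<xi> 0 \<omega> = 0})"
      using nonneg_renewal_finite[OF nonneg that[unfolded atom_less_iff]]
        nonneg_unique_root[OF \<open>a > 0\<close> nonneg] by metis
    fix x assume x: "\<P>(\<omega> in M. \<eta> 0 \<omega> \<le> x) > 0"
    let ?C = "ereal a < neg_ln (emeasure M {\<omega> \<in> space M. \<xi> 0 \<omega> = 0}) \<and>
             (\<exists>\<gamma>. is_unique_root M (\<xi> 0) a \<gamma> \<and> laplace M (\<eta> 0) \<gamma> < \<infinity>)"
    have 1: "?C" if "exp_renewal M \<xi> \<eta> a x < \<infinity>"
      using nonneg_condition_of_exp_renewal_finite[OF \<open>a > 0\<close> nonneg x that] by simp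
    have 2: "exp_renewal M \<xi> \<eta> a y < \<infinity>" if ?C for y
      using nonneg_exp_renewal_finite[OF \<open>a > 0\<close> nonneg] that by blast
    \<comment> \<open>Monotonicity brings a finite value at some \<open>y \<ge> x\<close> back to
      \<open>x\<close>, the point at which the hypothesis on \<open>\<eta>\<close> is
      available.\<close>
    have 3: "exp_renewal M \<xi> \<eta> a x < \<infinity>" if "y \<ge> x" "exp_renewal M \<xi> \<eta> a y < \<infinity>" for y
      using exp_renewal_mono[OF that(1)] that(2) by (rule le_less_trans)
    show "?A x"
      unfolding moment_iff using 1 2 3 by blast
  qed
  moreover have "?minim \<and> ?B" if "\<P>(\<omega> in M. \<xi> 0 \<omega> < 0) > 0"
  proof -
    have neg: "emeasure (\<nu> a) {..<0} > 0"
      using that by (auto simp: emeasure_weighted_law emeasure_eq_measure ennreal_zero_less_mult_iff)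
    have 1: "signed_condition a" if "exp_renewal M \<xi> \<eta> a x < \<infinity>" for x
      by (rule signed_condition_of_exp_renewal_finite[OF \<open>a > 0\<close> neg that])
    have 2: "exp_renewal M \<xi> \<eta> a x < \<infinity>" if "signed_condition a" for x
      by (rule exp_renewal_finite_of_signed_condition[OF that])
    \<comment> \<open>The condition does not involve \<open>x\<close>, so a single finite value
      forces finiteness everywhere and the versions with some and all coincide.\<close>
    show ?thesis
      unfolding moment_iff signed_condition_def[symmetric]
      using ex_minimal_root_of_le_R[OF \<open>a > 0\<close> neg] 1 2 by blast
  qed
  ultimately show ?thesis by blast
qed

end
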